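(* Let $\mathscr{M}=(X,\mathcal{I})$ be a matroid on $|X|=n$ elements, let $1\le k<\mathrm{rk}(\mathscr{M})$, and let $\omega:X\to\mathbb{R}_{>0}$ be a weight function. Then $$\mathrm{I}_\omega(k)^2\ =\ \Bigl(1+\frac1k\Bigr)\Bigl(1+\frac{1}{n-k}\Bigr)\,\mathrm{I}_\omega(k-1)\,\mathrm{I}_\omega(k+1)$$ if and only if $\mathrm{girth}(\mathscr{M})>k+1$ and the weight function $\omega$ is uniform (that is, $\omega(x)=\omega(y)$ for all $x,y\in X$).
   Context: A matroid $\mathscr{M}=(X,\mathcal{I})$ is given by its finite ground set $X$ and its collection $\mathcal I\subseteq 2^X$ of independent sets; $\mathrm{rk}(\mathscr M)$ is the maximal size of an independent set; $\mathcal I_j=\{S\in\mathcal I: |S|=j\}$ and $\mathrm I(j)=|\mathcal I_j|$. For $\omega:X\to\mathbb R_{>0}$ put $\omega(S)=\prod_{x\in S}\omega(x)$ and $\mathrm I_\omega(j)=\sum_{S\in\mathcal I_j}\omega(S)$. The girth is $\mathrm{girth}(\mathscr M)=\min\{j: \mathrm I(j)<\binom{n}{j}\}$, i.e. the size of the smallest circuit, with $\min\varnothing=\infty$. *)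

theory Defs
  imports Complex_Main "HOL-Library.Extended_Nat"
begin

locale matroid =
  fixes X :: "'a set" and \<I> :: "'a set set"
  assumes finite_ground: "finite X"
    and indep_subset_ground: "S \<in> \<I> \<Longrightarrow> S \<subseteq> X"
    and empty_indep: "{} \<in> \<I>"
    and indep_hereditary: "S \<in> \<I> \<Longrightarrow> T \<subseteq> S \<Longrightarrow> T \<in> \<I>"
    and indep_augment:
      "S \<in> \<I> \<Longrightarrow> T \<in> \<I> \<Longrightarrow> card S < card T \<Longrightarrow> \<exists>x \<in> T - S. insert x S \<in> \<I>"

text \<open>
  The following notions take the family \<open>\<I>\<close> of independent sets (and, where needed, the ground
  set \<open>X\<close>) as arguments. They carry their intended meaning when \<open>matroid X \<I>\<close> holds; in
  particular \<open>\<I>\<close> is then finite and nonempty and all its members are finite.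
\<close>

definition matroid_rank :: "'a set set \<Rightarrow> nat" where
  "matroid_rank \<I> = Max (card ` \<I>)"

definition indep_of_size :: "'a set set \<Rightarrow> nat \<Rightarrow> 'a set set" where
  "indep_of_size \<I> j = {S \<in> \<I>. card S = j}"

definition indep_count :: "'a set set \<Rightarrow> nat \<Rightarrow> nat" where
  "indep_count \<I> j = card (indep_of_size \<I> j)"

definition set_weight :: "('a \<Rightarrow> real) \<Rightarrow> 'a set \<Rightarrow> real" where
  "set_weight \<omega> S = (\<Prod>x\<in>S. \<omega> x)"

definition weighted_indep_count :: "'a set set \<Rightarrow> ('a \<Rightarrow> real) \<Rightarrow> nat \<Rightarrow> real" where
  "weighted_indep_count \<I> \<omega> j = (\<Sum>S\<in>indep_of_size \<I> j. set_weight \<omega> S)"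

text \<open>
  The infimum is taken in \<^typ>\<open>enat\<close>: it is the minimum of the set if the set is nonempty
  and \<open>\<infinity>\<close> if it is empty, i.e. if every subset of \<open>X\<close> is independent.
\<close>

definition girth :: "'a set \<Rightarrow> 'a set set \<Rightarrow> enat" where
  "girth X \<I> = (INF j \<in> {j. indep_count \<I> j < card X choose j}. enat j)"

end

theory Submission
  imports Defs "HOL-Analysis.Convex"
begin

text \<open>
  Consider \<open>F(y, z) = \<Sum>\<^sub>S (n - |S|)! / (k + 1 - |S|)! y^(k + 1 - |S|) z^S\<close>, summed over the
  independent sets \<open>S\<close> of size at most \<open>k + 1\<close>. Differentiating it once in each direction in an
  independent set \<open>A\<close> of size at most \<open>k - 1\<close> and then \<open>k - 1 - |A|\<close> times in the direction
  \<open>(0, \<omega>)\<close> gives a quadratic form \<open>Q\<^sub>A\<close>. For \<open>A = {}\<close>, the reverse Cauchy-Schwarz inequality for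
  \<open>Q\<^sub>A\<close> at the vectors \<open>(0, \<omega>)\<close> and \<open>(1, 0)\<close> is the ultra-log-concavity inequality.
  The forms satisfy \<open>Q\<^sub>A(e\<^sub>i, v) = Q\<^bsub>A + i\<^esub>((0, \<omega>), v)\<close> and \<open>Q\<^sub>A = \<Sum>\<^sub>i \<omega>\<^sub>i Q\<^bsub>A + i\<^esub>\<close>, so hyperbolicity
  passes from all \<open>Q\<^bsub>A + i\<^esub>\<close> to \<open>Q\<^sub>A\<close>; for \<open>|A| = k - 1\<close> it is the Cauchy-Schwarz inequality over
  the parallel classes of \<open>M / A\<close>. In the case of equality, \<open>(1, 0) - c (0, \<omega>)\<close> lies in the kernel
  of \<open>Q\<^bsub>{}\<^esub>\<close>, hence in the kernel of every \<open>Q\<^sub>A\<close>. For \<open>|A| = k - 1\<close> this forces each parallel class of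
  \<open>M / A\<close> to have weight \<open>1 / c\<close> and to be a singleton, and \<open>M / A\<close> to have no loops.
\<close>

section \<open>Hyperbolic quadratic forms\<close>

text \<open>Gaussian elimination by induction on the columns: a column with a nonzero entry
  \<open>L i0 j\<close> is cleared by subtracting multiples of row \<open>i0\<close>, and a solution
  or a certificate for the reduced system is lifted back.\<close>

lemma fredholm_alternative:
  fixes L :: "'b \<Rightarrow> 'c \<Rightarrow> real"
  assumes "finite I" "finite J"
  shows "(\<exists>z. \<forall>i\<in>I. (\<Sum>j\<in>J. L i j * z j) = r i) \<or>
         (\<exists>y. (\<forall>j\<in>J. (\<Sum>i\<in>I. y i * L i j) = 0) \<and> (\<Sum>i\<in>I. y i * r i) \<noteq> 0)"
  using assms(2)
proof (induction J arbitrary: L r rule: finite_induct)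
  case empty
  show ?case
  proof (cases "\<forall>i\<in>I. r i = 0")
    case False
    then obtain i where "i \<in> I" "r i \<noteq> 0" by blast
    with assms(1) have "(\<Sum>l\<in>I. (if l = i then 1 else 0) * r l) \<noteq> 0"
      by (simp add: if_distrib[of "\<lambda>x. x * _"] cong: if_cong)
    then show ?thesis by (intro disjI2 exI[of _ "\<lambda>l. if l = i then 1 else 0"]) simp
  qed simp
next
  case (insert j J)
  show ?case
  proof (cases "\<forall>i\<in>I. L i j = 0")
    case True
    with insert.IH[of L r] insert.hyps show ?thesis by simp
  next
    case False
    then obtain i0 where i0: "i0 \<in> I" "L i0 j \<noteq> 0" by blast
    define c where "c i = L i j / L i0 j" for i
    from insert.IH[of "\<lambda>i k. L i k - c i * L i0 k" "\<lambda>i. r i - c i * r i0"]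
    consider (sol) z where "\<forall>i\<in>I. (\<Sum>k\<in>J. (L i k - c i * L i0 k) * z k) = r i - c i * r i0"
      | (cert) y where "\<forall>k\<in>J. (\<Sum>i\<in>I. y i * (L i k - c i * L i0 k)) = 0"
          "(\<Sum>i\<in>I. y i * (r i - c i * r i0)) \<noteq> 0" by blast
    then show ?thesis
    proof cases
      case sol
      \<comment> \<open>The new coordinate is chosen to satisfy row \<open>i0\<close>; every other
        row is its reduced row plus \<open>c i\<close> times row \<open>i0\<close>.\<close>
      define z' where "z' = z(j := (r i0 - (\<Sum>k\<in>J. L i0 k * z k)) / L i0 j)"
      have z': "(\<Sum>k\<in>J. f k * z' k) = (\<Sum>k\<in>J. f k * z k)" for f
        using insert.hyps by (intro sum.cong) (auto simp: z'_def)
      have "(\<Sum>k\<in>insert j J. L i k * z' k) = r i" if "i \<in> I" for i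
      proof -
        have "r i - c i * r i0 = (\<Sum>k\<in>J. L i k * z k) - c i * (\<Sum>k\<in>J. L i0 k * z k)"
          using sol that by (simp add: left_diff_distrib sum_subtractf sum_distrib_left mult.assoc)
        moreover have "L i j * z' j = c i * (r i0 - (\<Sum>k\<in>J. L i0 k * z k))"
          by (simp add: z'_def c_def)
        ultimately show ?thesis
          using insert.hyps by (simp add: z' right_diff_distrib)
      qed
      then show ?thesis by blast
    next
      case cert
      \<comment> \<open>With this correction at \<open>i0\<close>, pairing \<open>y'\<close> with
        the rows amounts to pairing \<open>y\<close> with the reduced rows, whose entries in column
        \<open>j\<close> vanish.\<close>
      define y' where "y' = y(i0 := y i0 - (\<Sum>i\<in>I. y i * c i))"
      have y': "(\<Sum>i\<in>I. y' i * f i) = (\<Sum>i\<in>I. y i * (f i - c i * f i0))" for f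
      proof -
        have "(\<Sum>i\<in>I. y' i * f i) =
            (\<Sum>i\<in>I. y i * f i - (if i = i0 then (\<Sum>i\<in>I. y i * c i) * f i0 else 0))"
          by (intro sum.cong) (auto simp: y'_def algebra_simps)
        also have "\<dots> = (\<Sum>i\<in>I. y i * f i) - (\<Sum>i\<in>I. y i * c i) * f i0"
          using assms(1) i0 by (simp add: sum_subtractf)
        finally show ?thesis
          by (simp add: right_diff_distrib sum_subtractf sum_distrib_right mult.assoc)
      qed
      have "(\<Sum>i\<in>I. y' i * L i k) = 0" if "k \<in> insert j J" for k
        using that cert(1) i0 by (auto simp: y' c_def)
      moreover have "(\<Sum>i\<in>I. y' i * r i) \<noteq> 0" using cert(2) by (simp add: y')
      ultimately show ?thesis by blast
    qed
  qed
qed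

definition qform :: "'b set \<Rightarrow> ('b \<Rightarrow> 'b \<Rightarrow> real) \<Rightarrow> ('b \<Rightarrow> real) \<Rightarrow> ('b \<Rightarrow> real) \<Rightarrow> real" where
  "qform V G v w = (\<Sum>p\<in>V. \<Sum>q\<in>V. v p * G p q * w q)"

text \<open>For symmetric \<open>G\<close> and finite \<open>V\<close> this is positivity at
  \<open>h\<close> together with having exactly one positive eigenvalue, stated without eigenvalues.
  A kernel is permitted.\<close>

definition hyperbolic :: "'b set \<Rightarrow> ('b \<Rightarrow> 'b \<Rightarrow> real) \<Rightarrow> ('b \<Rightarrow> real) \<Rightarrow> bool" where
  "hyperbolic V G h \<longleftrightarrow> 0 < qform V G h h \<and> (\<forall>v. qform V G h v = 0 \<longrightarrow> qform V G v v \<le> 0)"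

lemma qform_rows: "qform V G v w = (\<Sum>p\<in>V. v p * (\<Sum>q\<in>V. G p q * w q))"
  by (simp add: qform_def sum_distrib_left mult.assoc)

lemma qform_add_scaled_right:
  "qform V G v (\<lambda>p. w p + c * w' p) = qform V G v w + c * qform V G v w'"
  by (simp add: qform_def sum_distrib_left distrib_left sum.distrib mult.left_commute)

lemma qform_commute:
  assumes "\<forall>p q. G p q = G q p"
  shows "qform V G v w = qform V G w v"
proof -
  have "v p * G p q * w q = w q * G q p * v p" for p q
  proof -
    have "G q p = G p q" using assms by blast
    then show ?thesis by (simp only: mult_ac)
  qed
  then show ?thesis
    unfolding qform_def
    by (subst sum.swap) (rule sum.cong[OF refl], rule sum.cong[OF refl], simp only:)
qed

lemma qform_add_scaled:
  assumes "\<forall>p q. G p q = G q p"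
  shows "qform V G (\<lambda>p. v p + c * w p) (\<lambda>p. v p + c * w p) =
    qform V G v v + 2 * c * qform V G v w + c\<^sup>2 * qform V G w w"
proof -
  have "qform V G (\<lambda>p. v p + c * w p) u = qform V G v u + c * qform V G w u" for u
    by (simp add: qform_rows sum_distrib_left distrib_right sum.distrib mult.assoc)
  moreover have "qform V G w v = qform V G v w" using assms by (rule qform_commute)
  ultimately show ?thesis
    by (simp add: qform_add_scaled_right power2_eq_square distrib_left)
qed

text \<open>Subtracting from \<open>v\<close> its component along \<open>h\<close> leaves a vector
  orthogonal to \<open>h\<close>, where the form is nonpositive; expanding gives the
  inequality.\<close>

lemma hyperbolic_reverse_cauchy_schwarz:
  assumes sym: "\<forall>p q. G p q = G q p" and hyp: "hyperbolic V G h"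
  shows "qform V G h h * qform V G v v \<le> (qform V G h v)\<^sup>2"
proof -
  define c where "c = - qform V G h v / qform V G h h"
  have pos: "0 < qform V G h h" using hyp by (simp add: hyperbolic_def)
  have "qform V G h (\<lambda>p. v p + c * h p) = 0"
    unfolding qform_add_scaled_right using pos by (simp add: c_def)
  then have "qform V G (\<lambda>p. v p + c * h p) (\<lambda>p. v p + c * h p) \<le> 0"
    using hyp by (simp add: hyperbolic_def)
  then have "qform V G v v - (qform V G h v)\<^sup>2 / qform V G h h \<le> 0"
    unfolding qform_add_scaled[OF sym] qform_commute[OF sym, where v = v and w = h] using pos
    by (simp add: c_def power2_eq_square field_simps)
  then show ?thesis using pos by (simp add: field_simps)
qed

text \<open>The reverse Cauchy-Schwarz inequality at \<open>w + c v\<close> is affine in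
  \<open>c\<close>, because \<open>v\<close> is null and orthogonal to \<open>h\<close>. It holds
  for all \<open>c\<close> only if its slope, a multiple of Q(w, v), is zero; unit vectors
  \<open>w\<close> give the rows.\<close>

lemma hyperbolic_null_vector:
  assumes fin: "finite V" and sym: "\<forall>p q. G p q = G q p" and hyp: "hyperbolic V G h"
    and orth: "qform V G h v = 0" and null: "qform V G v v = 0" and p: "p \<in> V"
  shows "(\<Sum>q\<in>V. G p q * v q) = 0"
proof -
  define w where "w = (\<lambda>q. if q = p then 1 else 0 :: real)"
  have w: "qform V G w v = (\<Sum>q\<in>V. G p q * v q)"
    using fin p by (simp add: qform_rows w_def if_distrib[of "\<lambda>x. x * _"] cong: if_cong)
  define b where "b = qform V G w v"
  have *: "0 \<le> (qform V G h w)\<^sup>2 - qform V G h h * (qform V G w w + 2 * c * b)" for c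
    using hyperbolic_reverse_cauchy_schwarz[OF sym hyp, of "\<lambda>p. w p + c * v p"]
    unfolding qform_add_scaled[OF sym] unfolding qform_add_scaled_right
    by (simp add: orth null b_def)
  have pos: "0 < qform V G h h" using hyp by (simp add: hyperbolic_def)
  have "b = 0"
  proof (rule ccontr)
    assume "b \<noteq> 0"
    \<comment> \<open>For this \<open>c\<close> the right-hand side of \<open>*\<close> equals
      \<open>- qform V G h h\<close>, which is negative.\<close>
    with pos *[of "((qform V G h w)\<^sup>2 / qform V G h h - qform V G w w + 1) / (2 * b)"]
    show False by (simp add: field_simps)
  qed
  then show ?thesis by (simp add: b_def w)
qed

text \<open>Expanding the square gives two diagonal sums, equal by symmetry of \<open>G\<close>, and
  a cross term. The left side is the energy of the Laplacian d - G, where d = (G h) / h is chosen so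
  that \<open>h\<close> lies in its kernel.\<close>

lemma dirichlet_form:
  fixes h u :: "'b \<Rightarrow> real"
  assumes sym: "\<forall>p q. G p q = G q p" and hN: "\<forall>p\<in>N. 0 < h p"
  shows "(\<Sum>p\<in>N. (\<Sum>q\<in>N. G p q * h q) / h p * (u p)\<^sup>2) - (\<Sum>p\<in>N. \<Sum>q\<in>N. u p * G p q * u q)
    = (\<Sum>p\<in>N. \<Sum>q\<in>N. G p q * h p * h q * (u p / h p - u q / h q)\<^sup>2) / 2"
proof -
  have h: "0 < h p" if "p \<in> N" for p using hN that by blast
  define S where "S = (\<Sum>p\<in>N. \<Sum>q\<in>N. G p q * h q / h p * (u p)\<^sup>2)"
  have S': "S = (\<Sum>p\<in>N. \<Sum>q\<in>N. G p q * h p / h q * (u q)\<^sup>2)"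
  proof -
    have "G p q * h q / h p * (u p)\<^sup>2 = G q p * h q / h p * (u p)\<^sup>2" for p q
      using sym by metis
    then show ?thesis
      unfolding S_def
      by (subst sum.swap) (rule sum.cong[OF refl], rule sum.cong[OF refl], simp only:)
  qed
  have "(\<Sum>p\<in>N. \<Sum>q\<in>N. G p q * h p * h q * (u p / h p - u q / h q)\<^sup>2) =
    (\<Sum>p\<in>N. \<Sum>q\<in>N. G p q * h q / h p * (u p)\<^sup>2 + G p q * h p / h q * (u q)\<^sup>2
        - 2 * (u p * G p q * u q))"
  proof (intro sum.cong refl)
    fix p q assume "p \<in> N" "q \<in> N"
    then have "h p \<noteq> 0" "h q \<noteq> 0" using h by (metis less_irrefl)+
    then show "G p q * h p * h q * (u p / h p - u q / h q)\<^sup>2 =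
      G p q * h q / h p * (u p)\<^sup>2 + G p q * h p / h q * (u q)\<^sup>2 - 2 * (u p * G p q * u q)"
      by (simp add: field_simps power2_eq_square)
  qed
  also have "\<dots> = S + S - 2 * (\<Sum>p\<in>N. \<Sum>q\<in>N. u p * G p q * u q)"
    unfolding sum_subtractf sum.distrib S_def[symmetric] S'[symmetric]
    by (simp add: sum_distrib_left)
  finally have *: "(\<Sum>p\<in>N. \<Sum>q\<in>N. G p q * h p * h q * (u p / h p - u q / h q)\<^sup>2) / 2 =
      S - (\<Sum>p\<in>N. \<Sum>q\<in>N. u p * G p q * u q)"
    by simp
  show ?thesis
    unfolding * by (simp add: S_def sum_distrib_right sum_divide_distrib)
qed

text \<open>Connectedness of the graph of positive entries, phrased through functions constant along
  edges instead of paths, since the kernel of a Laplacian yields such a function.\<close>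

definition connected_on :: "'b set \<Rightarrow> ('b \<Rightarrow> 'b \<Rightarrow> real) \<Rightarrow> bool" where
  "connected_on N G \<longleftrightarrow> (\<forall>f :: 'b \<Rightarrow> real. (\<forall>p\<in>N. \<forall>q\<in>N. 0 < G p q \<longrightarrow> f p = f q) \<longrightarrow>
    (\<forall>p\<in>N. \<forall>q\<in>N. f p = f q))"

text \<open>By the Dirichlet identity a kernel vector \<open>y\<close> of the Laplacian has y / h
  constant along edges, so by connectedness it is a multiple of \<open>h\<close>. The Fredholm
  alternative then turns orthogonality of \<open>r\<close> to \<open>h\<close> into
  solvability.\<close>

lemma laplacian_solvable:
  fixes h :: "'b \<Rightarrow> real"
  assumes fin: "finite N" and sym: "\<forall>p q. G p q = G q p" and hN: "\<forall>p\<in>N. 0 < h p"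
    and nonneg: "\<forall>p\<in>N. \<forall>q\<in>N. 0 \<le> G p q"
    and conn: "connected_on N G"
    and r: "(\<Sum>p\<in>N. h p * r p) = 0"
  obtains u where "\<And>p. p \<in> N \<Longrightarrow>
    (\<Sum>q\<in>N. G p q * h q) / h p * u p - (\<Sum>q\<in>N. G p q * u q) = r p"
proof -
  have h: "0 < h p" if "p \<in> N" for p using hN that by blast
  define d where "d p = (\<Sum>q\<in>N. G p q * h q) / h p" for p
  define L where "L p q = (if p = q then d p else 0) - G p q" for p q
  have L: "(\<Sum>q\<in>N. L p q * u q) = d p * u p - (\<Sum>q\<in>N. G p q * u q)" if "p \<in> N" for p u
    using that fin
    by (simp add: L_def left_diff_distrib sum_subtractf if_distrib[of "\<lambda>x. x * _"] cong: if_cong)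
  have Lsym: "L p q = L q p" for p q
    unfolding L_def by (metis sym)
  have "(\<Sum>p\<in>N. y p * r p) = 0" if y: "\<forall>q\<in>N. (\<Sum>p\<in>N. y p * L p q) = 0" for y
  proof -
    have "d p * y p - (\<Sum>q\<in>N. G p q * y q) = 0" if "p \<in> N" for p
    proof -
      have "L p q * y q = y q * L q p" for q using Lsym by (metis mult.commute)
      then have "(\<Sum>q\<in>N. L p q * y q) = (\<Sum>q\<in>N. y q * L q p)" by (rule sum.cong[OF refl])
      then show ?thesis using bspec[OF y that] L[OF that, of y] by linarith
    qed
    then have "(\<Sum>p\<in>N. y p * (d p * y p - (\<Sum>q\<in>N. G p q * y q))) = 0" by simp
    then have "(\<Sum>p\<in>N. d p * (y p)\<^sup>2) - (\<Sum>p\<in>N. \<Sum>q\<in>N. y p * G p q * y q) = 0"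
      by (simp add: right_diff_distrib sum_subtractf sum_distrib_left power2_eq_square mult_ac)
    then have "(\<Sum>p\<in>N. \<Sum>q\<in>N. G p q * h p * h q * (y p / h p - y q / h q)\<^sup>2) = 0"
      using dirichlet_form[OF sym hN, where u = y]
      by (simp add: d_def)
    moreover have nn: "0 \<le> G p q * h p * h q * (y p / h p - y q / h q)\<^sup>2" if "p \<in> N" "q \<in> N" for p q
      using nonneg that h[OF that(1)] h[OF that(2)] by simp
    ultimately have zero: "G p q * h p * h q * (y p / h p - y q / h q)\<^sup>2 = 0"
      if "p \<in> N" "q \<in> N" for p q
      using that fin by (simp add: sum_nonneg_eq_0_iff sum_nonneg)
    have "y p / h p = y q / h q" if "p \<in> N" "q \<in> N" "0 < G p q" for p q
      using that zero[of p q] h[of p] h[of q] by simp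
    then have "\<forall>p\<in>N. \<forall>q\<in>N. 0 < G p q \<longrightarrow> y p / h p = y q / h q" by blast
    then have eq: "y p / h p = y q / h q" if "p \<in> N" "q \<in> N" for p q
      using spec[OF conn[unfolded connected_on_def], of "\<lambda>p. y p / h p"] that by blast
    show ?thesis
    proof (cases "N = {}")
      case False
      then obtain q where q: "q \<in> N" by blast
      have "y p = y q / h q * h p" if "p \<in> N" for p
        using eq[OF that q] h[OF that] by (simp add: field_simps)
      then have "(\<Sum>p\<in>N. y p * r p) = (\<Sum>p\<in>N. y q / h q * (h p * r p))"
        by (intro sum.cong) auto
      then show ?thesis unfolding sum_distrib_left[symmetric] r by simp
    qed simp
  qed
  then obtain u where "\<forall>p\<in>N. (\<Sum>q\<in>N. L p q * u q) = r p"
    using fredholm_alternative[OF fin fin, of L r] by blast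
  then show thesis using that[of u] L by (simp add: d_def)
qed

text \<open>
  Let \<open>d p = (G h)\<^sub>p / h\<^sub>p\<close>. For \<open>v\<close> orthogonal to \<open>h\<close>, solve \<open>(d - G) u = G v\<close> on \<open>N\<close> and put
  \<open>z = v + u\<close>, so that \<open>d u = G z\<close>. Then \<open>Q(v, v) = Q(z, z) - 2 Q(u, z) + Q(u, u)\<close>, where
  \<open>Q(u, z) = \<Sum> d u\<^sup>2\<close> bounds \<open>Q(z, z)\<close> by the last assumption and \<open>Q(u, u)\<close> by nonnegativity of the
  Dirichlet form.
\<close>
lemma hyperbolic_stepI:
  fixes h :: "'b \<Rightarrow> real"
  assumes fin: "finite V" and sub: "N \<subseteq> V" and sym: "\<forall>p q. G p q = G q p"
    and hN: "\<forall>p\<in>N. 0 < h p"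
    and off: "\<And>p q. p \<in> V - N \<Longrightarrow> q \<in> V \<Longrightarrow> h p * G p q = 0"
    and nonneg: "\<forall>p\<in>N. \<forall>q\<in>N. 0 \<le> G p q"
    and conn: "connected_on N G"
    and ne: "N \<noteq> {}"
    and pos: "\<And>p. p \<in> N \<Longrightarrow> 0 < (\<Sum>q\<in>V. G p q * h q)"
    and local: "\<And>v. qform V G v v \<le>
      (\<Sum>p\<in>N. h p * (\<Sum>q\<in>V. G p q * v q)\<^sup>2 / (\<Sum>q\<in>V. G p q * h q))"
  shows "hyperbolic V G h"
  unfolding hyperbolic_def
proof (intro conjI allI impI)
  have h: "0 < h p" if "p \<in> N" for p using hN that by blast
  have finN: "finite N" using fin sub by (rule finite_subset[rotated])
  have left: "qform V G h v = (\<Sum>p\<in>N. h p * (\<Sum>q\<in>V. G p q * v q))" for v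
    unfolding qform_rows using fin sub
    by (intro sum.mono_neutral_right) (auto simp: off sum_distrib_left mult.assoc[symmetric])
  have "0 < (\<Sum>p\<in>N. h p * (\<Sum>q\<in>V. G p q * h q))"
    using finN ne h pos by (intro sum_pos) auto
  then show "0 < qform V G h h" by (simp add: left)
  fix v assume orth: "qform V G h v = 0"
  define row where "row p w = (\<Sum>q\<in>V. G p q * w q)" for p w
  define d where "d p = row p h / h p" for p
  \<comment> \<open>By \<open>off\<close> and symmetry, the columns outside \<open>N\<close>
    contribute nothing when paired with \<open>h\<close>.\<close>
  have rowN: "row p h = (\<Sum>q\<in>N. G p q * h q)" if "p \<in> N" for p
    unfolding row_def
  proof (intro sum.mono_neutral_right fin sub ballI)
    fix q assume "q \<in> V - N"
    then show "G p q * h q = 0"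
      using off[of q p] sub that sym[rule_format, of p q] by (auto simp: mult.commute)
  qed
  have "(\<Sum>p\<in>N. h p * row p v) = 0" using orth by (simp add: left row_def)
  then obtain u0 where u0: "\<And>p. p \<in> N \<Longrightarrow>
      (\<Sum>q\<in>N. G p q * h q) / h p * u0 p - (\<Sum>q\<in>N. G p q * u0 q) = row p v"
    using laplacian_solvable[OF finN sym hN nonneg conn, where r = "\<lambda>p. row p v"] by blast
  define u where "u p = (if p \<in> N then u0 p else 0)" for p
  have uV: "(\<Sum>q\<in>V. f q * u q) = (\<Sum>q\<in>N. f q * u q)" for f
    using fin sub by (intro sum.mono_neutral_right) (auto simp: u_def)
  have u: "d p * u p - row p u = row p v" if "p \<in> N" for p
  proof -
    have "row p u = (\<Sum>q\<in>N. G p q * u0 q)" unfolding row_def uV by (simp add: u_def)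
    then show ?thesis using u0[OF that] that by (simp add: d_def rowN u_def)
  qed
  define z where "z p = v p + 1 * u p" for p
  have rowz: "row p z = d p * u p" if "p \<in> N" for p
  proof -
    have "row p z = row p v + row p u" by (simp add: row_def z_def distrib_left sum.distrib)
    then show ?thesis using u[OF that] by simp
  qed
  have v: "v = (\<lambda>p. z p + (-1) * u p)" by (simp add: z_def)
  have quadu: "qform V G u w = (\<Sum>p\<in>N. u p * row p w)" for w
    using uV[of "\<lambda>p. row p w"] by (simp add: qform_rows row_def mult.commute)
  have "qform V G u z = (\<Sum>p\<in>N. d p * (u p)\<^sup>2)"
    by (simp add: quadu rowz power2_eq_square mult_ac)
  moreover have "qform V G z z \<le> (\<Sum>p\<in>N. d p * (u p)\<^sup>2)"
  proof -
    have "(\<Sum>p\<in>N. h p * (row p z)\<^sup>2 / row p h) = (\<Sum>p\<in>N. d p * (u p)\<^sup>2)"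
    proof (intro sum.cong refl)
      fix p assume p: "p \<in> N"
      show "h p * (row p z)\<^sup>2 / row p h = d p * (u p)\<^sup>2"
        using h[OF p] pos[OF p] unfolding row_def[symmetric] rowz[OF p]
        by (simp add: d_def power2_eq_square)
    qed
    then show ?thesis using local[of z] by (simp add: row_def)
  qed
  moreover have "qform V G u u \<le> (\<Sum>p\<in>N. d p * (u p)\<^sup>2)"
  proof -
    have "qform V G u u = (\<Sum>p\<in>N. \<Sum>q\<in>N. u p * G p q * u q)"
      by (simp add: quadu row_def uV sum_distrib_left mult.assoc)
    moreover have "0 \<le> (\<Sum>p\<in>N. \<Sum>q\<in>N. G p q * h p * h q * (u p / h p - u q / h q)\<^sup>2) / 2"
      using h nonneg by (intro divide_nonneg_nonneg sum_nonneg) (simp_all add: less_imp_le)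
    ultimately show ?thesis
      using dirichlet_form[OF sym hN, where u = u] by (simp add: d_def rowN)
  qed
  ultimately show "qform V G v v \<le> 0"
    unfolding v qform_add_scaled[OF sym] by (simp add: qform_commute[OF sym, where v = z and w = u])
qed

text \<open>One hyperplane on which the form is nonpositive is enough. It misses \<open>h\<close>,
  so a vector \<open>v\<close> orthogonal to \<open>h\<close> enters it after adding some
  \<open>t h\<close>; there is no cross term, and Q(v, v) + t^2 Q(h, h) \<le> 0 follows.\<close>

lemma hyperbolicI:
  assumes sym: "\<forall>p q. G p q = G q p" and pos: "0 < qform V G h h"
    and neg: "\<And>v. (\<Sum>p\<in>V. c p * v p) = 0 \<Longrightarrow> qform V G v v \<le> 0"
  shows "hyperbolic V G h"
  unfolding hyperbolic_def
proof (intro conjI allI impI pos)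
  fix v assume orth: "qform V G h v = 0"
  define l where "l v = (\<Sum>p\<in>V. c p * v p)" for v
  define t where "t = - l v / l h"
  have "l h \<noteq> 0" using neg[of h] pos by (auto simp: l_def)
  moreover have "l (\<lambda>p. v p + t * h p) = l v + t * l h"
    by (simp add: l_def distrib_left sum.distrib sum_distrib_left mult_ac)
  ultimately have "l (\<lambda>p. v p + t * h p) = 0" by (simp add: t_def)
  then have "qform V G (\<lambda>p. v p + t * h p) (\<lambda>p. v p + t * h p) \<le> 0"
    using neg by (simp add: l_def)
  then have "qform V G v v + t\<^sup>2 * qform V G h h \<le> 0"
    unfolding qform_add_scaled[OF sym] qform_commute[OF sym, where v = v and w = h]
    by (simp add: orth)
  moreover have "0 \<le> t\<^sup>2 * qform V G h h" using pos by simp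
  ultimately show "qform V G v v \<le> 0" by linarith
qed

text \<open>The double sum is the sum of the squared class sums, so this is Cauchy-Schwarz against
  the all-ones vector on at most \<open>m\<close> classes.\<close>

lemma sum_by_classes_squared_le:
  fixes f :: "'a \<Rightarrow> real" and cl :: "'a \<Rightarrow> 'b"
  assumes "finite N" "real (card (cl ` N)) \<le> m"
  shows "(\<Sum>i\<in>N. f i)\<^sup>2 \<le> m * (\<Sum>i\<in>N. \<Sum>j\<in>{j\<in>N. cl j = cl i}. f i * f j)"
proof -
  define s where "s c = (\<Sum>i\<in>{i\<in>N. cl i = c}. f i)" for c
  have "(\<Sum>i\<in>N. f i)\<^sup>2 = (\<Sum>c\<in>cl ` N. 1 * s c)\<^sup>2"
    using sum.image_gen[OF assms(1), of f cl] by (simp add: s_def)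
  also have "\<dots> \<le> (\<Sum>c\<in>cl ` N. 1\<^sup>2) * (\<Sum>c\<in>cl ` N. (s c)\<^sup>2)"
    by (rule Cauchy_Schwarz_ineq_sum)
  also have "\<dots> \<le> m * (\<Sum>c\<in>cl ` N. (s c)\<^sup>2)"
    using assms(2) by (intro mult_right_mono sum_nonneg) auto
  also have "(\<Sum>c\<in>cl ` N. (s c)\<^sup>2) = (\<Sum>c\<in>cl ` N. \<Sum>i\<in>{i\<in>N. cl i = c}. f i * s c)"
    by (simp add: s_def power2_eq_square sum_distrib_right)
  also have "\<dots> = (\<Sum>c\<in>cl ` N. \<Sum>i\<in>{i\<in>N. cl i = c}. f i * s (cl i))"
    by (intro sum.cong refl) simp
  also have "\<dots> = (\<Sum>i\<in>N. f i * s (cl i))"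
    by (rule sum.image_gen[OF assms(1), symmetric])
  finally show ?thesis by (simp add: s_def sum_distrib_left)
qed

section \<open>Weighted sums over chains of sets\<close>

text \<open>Models \<open>j\<close>-fold differentiation in direction \<omega>: new elements join
  \<open>A\<close> one at a time, each contributing its weight. Using ordered chains makes one
  derivative one step of the recursion.\<close>

primrec chain_sum :: "'a set \<Rightarrow> ('a \<Rightarrow> real) \<Rightarrow> nat \<Rightarrow> ('a set \<Rightarrow> real) \<Rightarrow> 'a set \<Rightarrow> real" where
  "chain_sum X \<omega> 0 f A = f A"
| "chain_sum X \<omega> (Suc j) f A = (\<Sum>i\<in>X - A. \<omega> i * chain_sum X \<omega> j f (insert i A))"

text \<open>Peeling off the last element of the chain instead of the first keeps the starting set
  fixed.\<close>

lemma chain_sum_Suc_right: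
  "chain_sum X \<omega> (Suc j) f A = chain_sum X \<omega> j (\<lambda>S. \<Sum>i\<in>X - S. \<omega> i * f (insert i S)) A"
  by (induction j arbitrary: A) simp_all

lemma chain_sum_eq_0:
  "(\<And>S. A \<subseteq> S \<Longrightarrow> f S = 0) \<Longrightarrow> chain_sum X \<omega> j f A = 0"
proof (induction j arbitrary: A)
  case (Suc j)
  have "chain_sum X \<omega> j f (insert i A) = 0" for i
    by (rule Suc.IH) (use Suc.prems in blast)
  then show ?case by simp
qed simp

lemma chain_sum_nonneg:
  assumes "\<forall>i\<in>X. 0 < \<omega> i" "\<And>S. 0 \<le> f S"
  shows "0 \<le> chain_sum X \<omega> j f A"
  using assms(2)
proof (induction j arbitrary: A)
  case (Suc j)
  then show ?case
    using assms(1) by (simp, intro sum_nonneg mult_nonneg_nonneg) (auto simp: less_imp_le)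
qed simp

lemma chain_sum_linear:
  "chain_sum X \<omega> j (\<lambda>S. \<Sum>p\<in>V. c p * f p S) A = (\<Sum>p\<in>V. c p * chain_sum X \<omega> j (f p) A)"
proof (induction j arbitrary: A)
  case (Suc j)
  then show ?case
    by (simp add: sum_distrib_left sum.swap[of _ _ "X - A"] mult.left_commute)
qed simp

lemma chain_sum_scale:
  "chain_sum X \<omega> j (\<lambda>S. c * f S) A = c * chain_sum X \<omega> j f A"
  using chain_sum_linear[of X \<omega> j "\<lambda>_. c" "\<lambda>_. f" "{()}" A] by simp

text \<open>Each \<open>j\<close>-set is reached in j! orders. The induction step matches pairs of a
  \<open>j\<close>-set and an element outside it with pairs of a (j+1)-set and one of its elements,
  so each larger set is counted \<open>Suc j\<close> times.\<close>

lemma chain_sum_empty: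
  assumes fin: "finite X"
  shows "chain_sum X \<omega> j f {} = fact j * (\<Sum>S | S \<subseteq> X \<and> card S = j. (\<Prod>x\<in>S. \<omega> x) * f S)"
proof (induction j arbitrary: f)
  case 0
  have "{S. S \<subseteq> X \<and> card S = 0} = {{}}" using fin by (auto dest: finite_subset)
  then show ?case by simp
next
  case (Suc j)
  define P where "P j = {S. S \<subseteq> X \<and> card S = j}" for j
  have finP: "finite (P j)" for j using fin by (simp add: P_def)
  have finS: "finite S" if "S \<in> P j" for S j using that fin by (auto simp: P_def dest: finite_subset)
  define w where "w S = (\<Prod>x\<in>S. \<omega> x) * f S" for S
  have "(\<Sum>S\<in>P j. (\<Prod>x\<in>S. \<omega> x) * (\<Sum>i\<in>X - S. \<omega> i * f (insert i S)))
      = (\<Sum>S\<in>P j. \<Sum>i\<in>X - S. w (insert i S))"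
    unfolding sum_distrib_left
  proof (intro sum.cong refl)
    fix S i assume "S \<in> P j" "i \<in> X - S"
    then show "(\<Prod>x\<in>S. \<omega> x) * (\<omega> i * f (insert i S)) = w (insert i S)"
      using finS by (simp add: w_def)
  qed
  also have "\<dots> = (\<Sum>a\<in>Sigma (P j) (\<lambda>S. X - S). w (insert (snd a) (fst a)))"
    using fin finP by (subst sum.Sigma) (auto simp: case_prod_beta)
  also have "\<dots> = (\<Sum>b\<in>Sigma (P (Suc j)) (\<lambda>T. T). w (fst b))"
  proof (rule sum.reindex_bij_witness[where
        i = "\<lambda>b. (fst b - {snd b}, snd b)" and j = "\<lambda>a. (insert (snd a) (fst a), snd a)"])
    fix a assume "a \<in> Sigma (P j) (\<lambda>S. X - S)"
    then obtain S i where a: "a = (S, i)" "S \<in> P j" "i \<in> X - S" by (cases a) simp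
    show "(insert (snd a) (fst a), snd a) \<in> Sigma (P (Suc j)) (\<lambda>T. T)"
      using a finS[OF a(2)] by (simp add: P_def)
    show "(fst (insert (snd a) (fst a), snd a) - {snd (insert (snd a) (fst a), snd a)},
        snd (insert (snd a) (fst a), snd a)) = a"
      using a by simp
  next
    fix b assume "b \<in> Sigma (P (Suc j)) (\<lambda>T. T)"
    then obtain T i where b: "b = (T, i)" "T \<in> P (Suc j)" "i \<in> T" by (cases b) simp
    show "(fst b - {snd b}, snd b) \<in> Sigma (P j) (\<lambda>S. X - S)"
      using b finS[OF b(2)] by (auto simp: P_def)
    show "(insert (snd (fst b - {snd b}, snd b)) (fst (fst b - {snd b}, snd b)),
        snd (fst b - {snd b}, snd b)) = b"
      using b by auto
  qed simp
  also have "\<dots> = (\<Sum>T\<in>P (Suc j). \<Sum>i\<in>T. w T)"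
    using finP finS by (subst sum.Sigma) (auto simp: case_prod_beta)
  also have "\<dots> = real (Suc j) * (\<Sum>T\<in>P (Suc j). w T)"
    by (simp add: P_def sum_distrib_left)
  finally have "chain_sum X \<omega> (Suc j) f {} = fact j * (real (Suc j) * (\<Sum>T\<in>P (Suc j). w T))"
    unfolding chain_sum_Suc_right Suc.IH P_def[symmetric] by (rule arg_cong)
  then show ?case by (simp add: P_def w_def)
qed

section \<open>The quadratic forms of a matroid\<close>

locale truncated_weighted_matroid = matroid X \<I> for X :: "'a set" and \<I> :: "'a set set" +
  fixes \<omega> :: "'a \<Rightarrow> real" and k :: nat
  assumes k_pos: "1 \<le> k" and k_less_rank: "k < matroid_rank \<I>"
    and weight_pos: "\<forall>x\<in>X. 0 < \<omega> x"
begin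

definition m :: real where "m = real (card X) - real k + 1"

text \<open>\<^term>\<open>None\<close> is the index of the homogenizing variable \<open>y\<close>.\<close>
definition V :: "'a option set" where "V = insert None (Some ` X)"

text \<open>The direction \<open>(0, \<omega>)\<close> in coordinates.\<close>

definition h :: "'a option \<Rightarrow> real" where "h p = (case p of None \<Rightarrow> 0 | Some i \<Rightarrow> \<omega> i)"

text \<open>
  The Hessian of the derivative of \<open>F\<close> along a set \<open>A\<close> of size \<open>k - 1\<close>, divided by
  \<open>(n - k - 1)!\<close>; then \<open>m = |X - A|\<close>.
\<close>
definition base :: "'a option \<Rightarrow> 'a option \<Rightarrow> 'a set \<Rightarrow> real" where
  "base p q A = (case (p, q) of
      (None, None) \<Rightarrow> m * (m - 1) * of_bool (A \<in> \<I>)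
    | (None, Some i) \<Rightarrow> (m - 1) * of_bool (i \<notin> A \<and> insert i A \<in> \<I>)
    | (Some i, None) \<Rightarrow> (m - 1) * of_bool (i \<notin> A \<and> insert i A \<in> \<I>)
    | (Some i, Some j) \<Rightarrow>
        of_bool (i \<noteq> j \<and> i \<notin> A \<and> j \<notin> A \<and> insert i (insert j A) \<in> \<I>))"

text \<open>For \<open>j = k - 1 - |A|\<close> this is the matrix of \<open>Q\<^sub>A\<close>, up to
  a constant factor. Keeping \<open>j\<close> as a separate argument allows plain induction on
  it.\<close>

definition form :: "nat \<Rightarrow> 'a set \<Rightarrow> 'a option \<Rightarrow> 'a option \<Rightarrow> real" where
  "form j A p q = chain_sum X \<omega> j (base p q) A"

lemma finite_indep: "S \<in> \<I> \<Longrightarrow> finite S"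
  using finite_subset[OF indep_subset_ground finite_ground] .

lemma large_indep: obtains S where "S \<in> \<I>" "Suc k \<le> card S"
proof -
  have "finite \<I>"
    using finite_ground indep_subset_ground by (intro finite_subset[of \<I> "Pow X"]) auto
  then have "matroid_rank \<I> \<in> card ` \<I>"
    unfolding matroid_rank_def using empty_indep by (intro Max_in) auto
  then show thesis using that k_less_rank by (metis Suc_leI imageE)
qed

lemma augmentable:
  assumes "A \<in> \<I>" "card A \<le> k"
  obtains x where "x \<in> X - A" "insert x A \<in> \<I>"
proof -
  obtain S where S: "S \<in> \<I>" "Suc k \<le> card S" by (rule large_indep)
  then obtain x where "x \<in> S - A" "insert x A \<in> \<I>"
    using indep_augment[OF assms(1) S(1)] assms(2) by auto
  then show thesis using that indep_subset_ground[OF S(1)] by blast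
qed

lemma k_less_card: "k < card X"
  using large_indep card_mono[OF finite_ground indep_subset_ground] by (metis Suc_le_lessD le_trans)

lemma m_ge_2: "2 \<le> m"
  using k_less_card by (simp add: m_def)

text \<open>Transitivity of parallelism in M / A, in contrapositive form: a non-loop
  \<open>p\<close> cannot be parallel to both members of an independent pair. Augment A + p from A +
  i + l.\<close>

lemma parallel_trans:
  assumes A: "A \<in> \<I>" and p: "insert p A \<in> \<I>" "p \<notin> A"
    and il: "i \<noteq> l" "i \<notin> A" "l \<notin> A" "insert i (insert l A) \<in> \<I>"
  shows "i \<noteq> p \<and> insert i (insert p A) \<in> \<I> \<or> l \<noteq> p \<and> insert l (insert p A) \<in> \<I>"
proof -
  have "finite A" using A by (rule finite_indep)
  then have "card (insert p A) < card (insert i (insert l A))" using p il by simp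
  then obtain x where "x \<in> insert i (insert l A) - insert p A" "insert x (insert p A) \<in> \<I>"
    using indep_augment[OF p(1) il(4)] by blast
  then show ?thesis by auto
qed

section \<open>Symmetry, vanishing and recursion of the forms\<close>

lemma finite_V: "finite V"
  by (simp add: V_def finite_ground)

lemma sum_V: "(\<Sum>p\<in>V. f p) = f None + (\<Sum>i\<in>X. f (Some i))"
  by (simp add: V_def finite_ground sum.reindex image_iff)

lemma base_sym: "base p q A = base q p A"
  by (auto simp: base_def insert_commute split: option.split)

lemma form_sym: "\<forall>p q. form j A p q = form j A q p"
proof (intro allI)
  fix p q
  have "base p q = base q p" by (rule ext) (rule base_sym)
  then show "form j A p q = form j A q p" by (simp add: form_def)
qed

lemma form_nonneg: "0 \<le> form j A p q"
  unfolding form_def using m_ge_2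
  by (intro chain_sum_nonneg weight_pos) (auto simp: base_def split: option.split)

lemma form_0: "form 0 A p q = base p q A"
  by (simp add: form_def)

lemma form_Suc: "form (Suc j) A p q = (\<Sum>i\<in>X - A. \<omega> i * form j (insert i A) p q)"
  by (simp add: form_def)

text \<open>Every set on a chain from \<open>A\<close> contains \<open>A\<close>, so
  \<open>i\<close> stays inside it or stays a loop; the corresponding rows vanish.\<close>

lemma form_eq_0:
  assumes "i \<in> A \<or> insert i A \<notin> \<I>"
  shows "form j A (Some i) q = 0"
  unfolding form_def
proof (rule chain_sum_eq_0)
  fix S assume S: "A \<subseteq> S"
  have "insert i S \<notin> \<I> \<and> insert i (insert l S) \<notin> \<I>" if "i \<notin> A" for l
    using assms that indep_hereditary[of _ "insert i A"] S by blast
  then show "base (Some i) q S = 0"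
    using S by (cases "i \<in> A") (auto simp: base_def split: option.split)
qed

lemma form_dependent: "A \<notin> \<I> \<Longrightarrow> form j A p q = 0"
  unfolding form_def
proof (rule chain_sum_eq_0)
  fix S assume "A \<notin> \<I>" "A \<subseteq> S"
  then have "S \<notin> \<I>" "insert i S \<notin> \<I>" "insert i (insert l S) \<notin> \<I>" for i l
    using indep_hereditary by blast+
  then show "base p q S = 0" by (auto simp: base_def split: option.split)
qed

lemma qform_dependent: "A \<notin> \<I> \<Longrightarrow> qform V (form j A) v w = 0"
  by (simp add: qform_def form_dependent)

text \<open>The entrywise version of \<open>Q\<^sub>A(e\<^sub>i, v) = Q(h, v)\<close> with Q the
  form of A + i. For \<open>j = 0\<close> both sides depend on \<open>i\<close> and \<open>l\<close>
  only through A + i + l; further derivatives commute with the sum.\<close>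

lemma form_row_step:
  assumes "i \<in> X - A"
  shows "form (Suc j) A (Some i) q = (\<Sum>l\<in>X. \<omega> l * form j (insert i A) (Some l) q)"
  using assms
proof (induction j arbitrary: A)
  case 0
  have "(\<Sum>l\<in>X. \<omega> l * base (Some l) q (insert i A)) = (\<Sum>l\<in>X - A. \<omega> l * base (Some l) q (insert i A))"
    using finite_ground
    by (intro sum.mono_neutral_right) (auto simp: base_def split: option.split)
  also have "\<dots> = (\<Sum>l\<in>X - A. \<omega> l * base (Some i) q (insert l A))"
    using 0 by (intro sum.cong refl) (auto simp: base_def insert_commute split: option.split)
  finally show ?case by (simp add: form_Suc form_0)
next
  case (Suc j)
  have "form (Suc (Suc j)) A (Some i) q = (\<Sum>l\<in>X - A. \<omega> l * form (Suc j) (insert l A) (Some i) q)"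
    by (rule form_Suc)
  \<comment> \<open>The term \<open>l = i\<close> drops out because row \<open>i\<close> of a form
    at a set containing \<open>i\<close> is zero.\<close>
  also have "\<dots> = (\<Sum>l\<in>X - insert i A. \<omega> l * form (Suc j) (insert l A) (Some i) q)"
    using finite_ground by (intro sum.mono_neutral_right) (auto simp: form_eq_0)
  also have "\<dots> = (\<Sum>l\<in>X - insert i A. \<omega> l * (\<Sum>p\<in>X. \<omega> p * form j (insert l (insert i A)) (Some p) q))"
  proof (intro sum.cong refl)
    fix l assume "l \<in> X - insert i A"
    then show "\<omega> l * form (Suc j) (insert l A) (Some i) q =
        \<omega> l * (\<Sum>p\<in>X. \<omega> p * form j (insert l (insert i A)) (Some p) q)"
      using Suc.IH[of "insert l A"] Suc.prems by (auto simp: insert_commute[of i l])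
  qed
  also have "\<dots> = (\<Sum>p\<in>X. \<omega> p * form (Suc j) (insert i A) (Some p) q)"
    by (simp add: form_Suc sum_distrib_left sum.swap[of _ _ "X - insert i A"] mult.left_commute)
  finally show ?case .
qed

lemma qform_h: "qform V G h v = (\<Sum>i\<in>X. \<omega> i * (\<Sum>q\<in>V. G (Some i) q * v q))"
  unfolding qform_rows by (subst sum_V) (simp add: h_def)

lemma row_form_Suc:
  assumes "i \<in> X - A"
  shows "(\<Sum>q\<in>V. form (Suc j) A (Some i) q * v q) = qform V (form j (insert i A)) h v"
  unfolding qform_h form_row_step[OF assms] sum_distrib_right sum_distrib_left
  by (subst sum.swap) (simp only: mult.assoc)

lemma qform_form: "qform V (form j A) v w = chain_sum X \<omega> j (\<lambda>S. qform V (\<lambda>p q. base p q S) v w) A"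
proof -
  have "chain_sum X \<omega> j (\<lambda>S. \<Sum>p\<in>V. v p * (\<Sum>q\<in>V. w q * base p q S)) A =
      (\<Sum>p\<in>V. v p * chain_sum X \<omega> j (\<lambda>S. \<Sum>q\<in>V. w q * base p q S) A)"
    by (rule chain_sum_linear)
  also have "\<dots> = (\<Sum>p\<in>V. v p * (\<Sum>q\<in>V. w q * form j A p q))"
    by (simp only: chain_sum_linear form_def)
  finally show ?thesis by (simp add: qform_rows mult.commute)
qed

lemma qform_form_Suc:
  "qform V (form (Suc j) A) v w = (\<Sum>i\<in>X - A. \<omega> i * qform V (form j (insert i A)) v w)"
  by (simp add: qform_form)

text \<open>All terms are nonnegative, so one chain from \<open>A\<close> to some S with S + i + l
  independent suffices. It exists since each augmentation along the way starts from at most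
  \<open>k\<close> elements, below the rank.\<close>

lemma form_pos:
  assumes "card A + j < k" "i \<noteq> l" "i \<in> X - A" "l \<in> X - A" "insert i (insert l A) \<in> \<I>"
  shows "0 < form j A (Some i) (Some l)"
  using assms
proof (induction j arbitrary: A)
  case 0
  then show ?case by (simp add: form_0 base_def)
next
  case (Suc j)
  have fin: "finite A" using finite_indep[OF Suc.prems(5)] by simp
  then have "card (insert i (insert l A)) \<le> k" using Suc.prems by simp
  then obtain x where x: "x \<in> X - insert i (insert l A)" "insert x (insert i (insert l A)) \<in> \<I>"
    using augmentable[OF Suc.prems(5)] by blast
  have "0 < form j (insert x A) (Some i) (Some l)"
    using x Suc.prems fin by (intro Suc.IH) (auto simp: insert_commute)
  then have "0 < \<omega> x * form j (insert x A) (Some i) (Some l)" using x weight_pos by simp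
  also have "\<dots> \<le> form (Suc j) A (Some i) (Some l)"
    unfolding form_Suc using x finite_ground weight_pos form_nonneg
    by (intro member_le_sum[where f = "\<lambda>x. \<omega> x * form j (insert x A) (Some i) (Some l)"])
      (auto simp: less_imp_le)
  finally show ?case .
qed

section \<open>Parallel classes of M / A and the base case |A| = k - 1\<close>

definition nonloops :: "'a set \<Rightarrow> 'a set" where "nonloops A = {i \<in> X - A. insert i A \<in> \<I>}"

definition parallel_class :: "'a set \<Rightarrow> 'a \<Rightarrow> 'a set" where
  "parallel_class A i = {l \<in> nonloops A. l = i \<or> insert i (insert l A) \<notin> \<I>}"

lemma finite_nonloops: "finite (nonloops A)"
  using finite_ground by (simp add: nonloops_def)

lemma nonloops_subset: "nonloops A \<subseteq> X"
  by (auto simp: nonloops_def)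

text \<open>Parallelism on the non-loops is an equivalence relation by
  \<open>parallel_trans\<close>. Stated as equality of classes, it lets
  \<open>parallel_class A\<close> serve as the classifying map in
  \<open>sum_by_classes_squared_le\<close>.\<close>

lemma parallel_class_eq_iff:
  assumes A: "A \<in> \<I>" and i: "i \<in> nonloops A" and l: "l \<in> nonloops A"
  shows "parallel_class A i = parallel_class A l \<longleftrightarrow> i = l \<or> insert i (insert l A) \<notin> \<I>"
proof
  assume "parallel_class A i = parallel_class A l"
  then have "l \<in> parallel_class A i" using l by (simp add: parallel_class_def)
  then show "i = l \<or> insert i (insert l A) \<notin> \<I>" by (auto simp: parallel_class_def)
next
  have *: "parallel_class A l \<subseteq> parallel_class A i"
    if il: "i \<in> nonloops A" "l \<in> nonloops A" "insert i (insert l A) \<notin> \<I>" for i l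
  proof
    fix x assume x: "x \<in> parallel_class A l"
    show "x \<in> parallel_class A i"
    proof (rule ccontr)
      assume "x \<notin> parallel_class A i"
      then have "i \<noteq> x" "insert i (insert x A) \<in> \<I>" "x \<in> nonloops A"
        using x by (auto simp: parallel_class_def)
      then have "i \<noteq> l \<and> insert i (insert l A) \<in> \<I> \<or> x \<noteq> l \<and> insert x (insert l A) \<in> \<I>"
        using il by (intro parallel_trans[OF A]) (auto simp: nonloops_def)
      then show False
        using il(3) x by (auto simp: parallel_class_def insert_commute)
    qed
  qed
  assume "i = l \<or> insert i (insert l A) \<notin> \<I>"
  then show "parallel_class A i = parallel_class A l"
    using *[OF i l] *[OF l i] by (auto simp: insert_commute)
qed

text \<open>On non-loops this block is the adjacency matrix of the complete multipartite graph whose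
  parts are the parallel classes.\<close>

lemma base_nonloops:
  assumes "A \<in> \<I>" "i \<in> nonloops A" "l \<in> nonloops A"
  shows "base (Some i) (Some l) A = 1 - of_bool (parallel_class A l = parallel_class A i)"
  using parallel_class_eq_iff[OF assms] assms by (auto simp: base_def nonloops_def)

lemma base_Some_loop: "i \<notin> nonloops A \<Longrightarrow> i \<in> X \<Longrightarrow> base (Some i) q A = 0"
  using form_eq_0[of i A 0 q] by (auto simp: nonloops_def form_0)

lemma sum_nonloops:
  assumes "\<And>i. i \<in> X - nonloops A \<Longrightarrow> f i = 0"
  shows "(\<Sum>i\<in>X. f i) = (\<Sum>i\<in>nonloops A. f i)"
  using assms finite_ground nonloops_subset by (intro sum.mono_neutral_right) auto

lemma row_base_None:
  assumes "A \<in> \<I>"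
  shows "(\<Sum>q\<in>V. base None q A * v q) =
    (m - 1) * (m * v None + (\<Sum>i\<in>nonloops A. v (Some i)))"
proof -
  have "(\<Sum>i\<in>X. base None (Some i) A * v (Some i)) = (\<Sum>i\<in>nonloops A. base None (Some i) A * v (Some i))"
    by (intro sum_nonloops) (simp add: base_sym[of None] base_Some_loop)
  also have "\<dots> = (\<Sum>i\<in>nonloops A. (m - 1) * v (Some i))"
    by (intro sum.cong refl) (simp add: base_def nonloops_def)
  finally show ?thesis
    using assms by (simp add: sum_V base_def sum_distrib_left algebra_simps)
qed

lemma row_base_Some:
  assumes A: "A \<in> \<I>" and i: "i \<in> nonloops A"
  shows "(\<Sum>q\<in>V. base (Some i) q A * v q) = (m - 1) * v None + (\<Sum>l\<in>nonloops A. v (Some l))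
    - (\<Sum>l\<in>{l\<in>nonloops A. parallel_class A l = parallel_class A i}. v (Some l))"
proof -
  have "(\<Sum>l\<in>X. base (Some i) (Some l) A * v (Some l)) =
      (\<Sum>l\<in>nonloops A. base (Some i) (Some l) A * v (Some l))"
    by (intro sum_nonloops) (simp add: base_sym[of "Some i"] base_Some_loop)
  also have "\<dots> = (\<Sum>l\<in>nonloops A. v (Some l)
      - (if parallel_class A l = parallel_class A i then v (Some l) else 0))"
    by (intro sum.cong refl) (simp add: base_nonloops[OF A i])
  also have "\<dots> = (\<Sum>l\<in>nonloops A. v (Some l))
      - (\<Sum>l\<in>{l\<in>nonloops A. parallel_class A l = parallel_class A i}. v (Some l))"
    unfolding sum_subtractf by (simp add: sum.inter_filter[OF finite_nonloops])
  finally show ?thesis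
    using i by (simp add: sum_V base_def nonloops_def)
qed

text \<open>Together these bound the number of parallel classes by \<open>m\<close>; in the case of
  equality the whole chain collapses.\<close>

lemma card_parallel_classes:
  assumes "A \<in> \<I>" "Suc (card A) = k"
  shows "card (parallel_class A ` nonloops A) \<le> card (nonloops A)" "card (nonloops A) \<le> card (X - A)"
    "real (card (X - A)) = m"
proof -
  show "card (parallel_class A ` nonloops A) \<le> card (nonloops A)" by (rule card_image_le[OF finite_nonloops])
  show "card (nonloops A) \<le> card (X - A)"
    using finite_ground by (intro card_mono) (auto simp: nonloops_def)
  have "card (X - A) = card X - card A"
    using finite_indep[OF assms(1)] indep_subset_ground[OF assms(1)] by (rule card_Diff_subset)
  then show "real (card (X - A)) = m"
    using assms(2) k_less_card by (simp add: m_def)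
qed

text \<open>On this hyperplane the form equals m v0^2 - E, with v0 the \<open>None\<close>
  coordinate and E the sum of the squared class sums. Cauchy-Schwarz over at most \<open>m\<close>
  classes gives (m v0)^2 \<le> m E.\<close>

lemma qform_base_nonpos:
  assumes A: "A \<in> \<I>" "Suc (card A) = k"
    and v: "m * v None + (\<Sum>i\<in>nonloops A. v (Some i)) = 0"
  shows "qform V (form 0 A) v v \<le> 0"
proof -
  define \<sigma> where "\<sigma> = (\<Sum>i\<in>nonloops A. v (Some i))"
  define E where "E = (\<Sum>i\<in>nonloops A. \<Sum>l\<in>{l\<in>nonloops A. parallel_class A l = parallel_class A i}.
    v (Some i) * v (Some l))"
  have "real (card (parallel_class A ` nonloops A)) \<le> m"
    using card_parallel_classes[OF A] by linarith
  then have E: "\<sigma>\<^sup>2 \<le> m * E"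
    unfolding \<sigma>_def E_def by (intro sum_by_classes_squared_le finite_nonloops)
  have "qform V (form 0 A) v v =
      v None * ((m - 1) * (m * v None + \<sigma>)) + (\<Sum>i\<in>X. v (Some i) * (\<Sum>q\<in>V. base (Some i) q A * v q))"
    unfolding qform_rows form_0 by (subst sum_V) (simp add: row_base_None[OF A(1)] \<sigma>_def)
  also have "(\<Sum>i\<in>X. v (Some i) * (\<Sum>q\<in>V. base (Some i) q A * v q)) =
      (\<Sum>i\<in>nonloops A. v (Some i) * (\<Sum>q\<in>V. base (Some i) q A * v q))"
    by (intro sum_nonloops) (simp add: base_Some_loop)
  also have "\<dots> = (\<Sum>i\<in>nonloops A. v (Some i) * ((m - 1) * v None + \<sigma>) -
      (\<Sum>l\<in>{l\<in>nonloops A. parallel_class A l = parallel_class A i}. v (Some i) * v (Some l)))"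
    by (intro sum.cong refl)
      (simp add: row_base_Some[OF A(1)] \<sigma>_def right_diff_distrib sum_distrib_left)
  also have "\<dots> = \<sigma> * ((m - 1) * v None + \<sigma>) - E"
    unfolding sum_subtractf E_def by (simp add: \<sigma>_def sum_distrib_right)
  finally have *: "qform V (form 0 A) v v =
      v None * ((m - 1) * (m * v None + \<sigma>)) + (\<sigma> * ((m - 1) * v None + \<sigma>) - E)" .
  have s: "\<sigma> = - m * v None" using v by (simp add: \<sigma>_def)
  have "qform V (form 0 A) v v = m * (v None)\<^sup>2 - E"
    unfolding * s by (simp add: algebra_simps power2_eq_square)
  moreover have "m * (v None)\<^sup>2 \<le> E"
  proof -
    have "m * (m * (v None)\<^sup>2) \<le> m * E"
      using E unfolding s by (simp add: power2_eq_square mult_ac)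
    then show ?thesis using m_ge_2 by simp
  qed
  ultimately show ?thesis by simp
qed

section \<open>Positivity, connectedness and hyperbolicity of all forms\<close>

lemma nonloops_nonempty: "A \<in> \<I> \<Longrightarrow> card A \<le> k \<Longrightarrow> nonloops A \<noteq> {}"
  using augmentable[of A] by (auto simp: nonloops_def)

lemma row_form_pos:
  assumes i: "i \<in> nonloops A" and c: "card A + j < k"
  shows "0 < (\<Sum>q\<in>V. form j A (Some i) q * h q)"
proof -
  have iA: "insert i A \<in> \<I>" "i \<in> X - A" using i by (auto simp: nonloops_def)
  have "card (insert i A) \<le> k" using c finite_indep[OF iA(1)] iA by simp
  then obtain x where x: "x \<in> X - insert i A" "insert x (insert i A) \<in> \<I>"
    using augmentable[OF iA(1)] by blast
  have nn: "0 \<le> form j A (Some i) q * h q" if "q \<in> V" for q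
    using form_nonneg weight_pos that
    by (auto simp: h_def V_def less_imp_le intro!: mult_nonneg_nonneg split: option.split)
  have "0 < form j A (Some i) (Some x)"
    using x iA c by (intro form_pos) (auto simp: insert_commute)
  then have "0 < form j A (Some i) (Some x) * h (Some x)" using x weight_pos by (simp add: h_def)
  then show ?thesis
    using x finite_V nn by (intro sum_pos2[of V "Some x"]) (auto simp: V_def)
qed

lemma qform_form_pos:
  assumes A: "A \<in> \<I>" and c: "card A + j < k"
  shows "0 < qform V (form j A) h h"
proof -
  obtain i where i: "i \<in> nonloops A" using nonloops_nonempty[OF A] c by auto
  have nn: "0 \<le> \<omega> l * (\<Sum>q\<in>V. form j A (Some l) q * h q)" if l: "l \<in> X" for l
  proof (cases "l \<in> nonloops A")
    case True
    then show ?thesis using row_form_pos[OF True c] weight_pos l by (simp add: less_imp_le)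
  next
    case False
    then have "form j A (Some l) q = 0" for q using l by (intro form_eq_0) (auto simp: nonloops_def)
    then show ?thesis by simp
  qed
  have "0 < \<omega> i * (\<Sum>q\<in>V. form j A (Some i) q * h q)"
    using row_form_pos[OF i c] weight_pos i nonloops_subset by (intro mult_pos_pos) auto
  then show ?thesis
    unfolding qform_h using i nonloops_subset nn finite_ground by (intro sum_pos2[of X i]) auto
qed

text \<open>Non-parallel non-loops are adjacent by \<open>form_pos\<close>. For any \<open>i\<close>
  and \<open>l\<close>, augmenting A + i gives a neighbour \<open>x\<close> of \<open>i\<close>, and
  by \<open>parallel_trans\<close> one of \<open>i\<close> and \<open>x\<close> is adjacent to
  \<open>l\<close>.\<close>

lemma connected_form:
  assumes A: "A \<in> \<I>" and c: "card A + j < k"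
  shows "connected_on (Some ` nonloops A) (form j A)"
  unfolding connected_on_def
proof (intro allI impI)
  fix f :: "'a option \<Rightarrow> real"
  assume f: "\<forall>p\<in>Some ` nonloops A. \<forall>q\<in>Some ` nonloops A. 0 < form j A p q \<longrightarrow> f p = f q"
  have edge: "f (Some i) = f (Some l)"
    if "i \<in> nonloops A" "l \<in> nonloops A" "i \<noteq> l" "insert i (insert l A) \<in> \<I>" for i l
    using f form_pos[OF c, of i l] that by (auto simp: nonloops_def)
  have "f (Some i) = f (Some l)" if i: "i \<in> nonloops A" and l: "l \<in> nonloops A" for i l
  proof -
    have iA: "insert i A \<in> \<I>" "i \<notin> A" "insert l A \<in> \<I>" "l \<notin> A"
      using i l by (auto simp: nonloops_def)
    have "card (insert i A) \<le> k" using c finite_indep[OF A] iA by simp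
    then obtain x where x: "x \<in> X - insert i A" "insert x (insert i A) \<in> \<I>"
      using augmentable[OF iA(1)] by blast
    have xN: "x \<in> nonloops A" using x indep_hereditary[OF x(2), of "insert x A"] by (auto simp: nonloops_def)
    have "i \<noteq> l \<and> insert i (insert l A) \<in> \<I> \<or> x \<noteq> l \<and> insert x (insert l A) \<in> \<I>"
      using x iA by (intro parallel_trans[OF A]) (auto simp: insert_commute)
    then show ?thesis
    proof
      assume "i \<noteq> l \<and> insert i (insert l A) \<in> \<I>"
      then show ?thesis using edge[OF i l] by simp
    next
      assume "x \<noteq> l \<and> insert x (insert l A) \<in> \<I>"
      then have "f (Some x) = f (Some l)" using edge[OF xN l] by simp
      moreover have "f (Some x) = f (Some i)" using edge[OF xN i] x by auto
      ultimately show ?thesis by simp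
    qed
  qed
  then show "\<forall>p\<in>Some ` nonloops A. \<forall>q\<in>Some ` nonloops A. f p = f q" by blast
qed

text \<open>In the induction step, Q_A is the weighted sum of the forms of A + i. The reverse
  Cauchy-Schwarz inequality bounds each of them by a squared row of Q_A over that row paired with
  \<open>h\<close>, as \<open>hyperbolic_stepI\<close> requires.\<close>

lemma form_hyperbolic:
  assumes "A \<in> \<I>" "Suc (card A + j) = k"
  shows "hyperbolic V (form j A) h"
  using assms
proof (induction j arbitrary: A)
  case 0
  show ?case
  proof (rule hyperbolicI[OF form_sym])
    show "0 < qform V (form 0 A) h h" using 0 by (intro qform_form_pos) auto
    fix v :: "'a option \<Rightarrow> real"
    \<comment> \<open>The functional is the \<open>None\<close> row of the form divided by
      \<open>m - 1\<close>.\<close>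
    assume "(\<Sum>p\<in>V. (case p of None \<Rightarrow> m | Some i \<Rightarrow> of_bool (i \<in> nonloops A)) * v p) = 0"
    then have "m * v None + (\<Sum>i\<in>X. of_bool (i \<in> nonloops A) * v (Some i)) = 0"
      by (simp add: sum_V)
    moreover have "(\<Sum>i\<in>X. of_bool (i \<in> nonloops A) * v (Some i)) = (\<Sum>i\<in>nonloops A. v (Some i))"
      by (subst sum_nonloops[of A]) auto
    ultimately show "qform V (form 0 A) v v \<le> 0" using 0 by (intro qform_base_nonpos) auto
  qed
next
  case (Suc j)
  let ?N = "Some ` nonloops A"
  have c: "card A + Suc j < k" using Suc.prems by simp
  show ?case
  proof (rule hyperbolic_stepI[where N = ?N, OF finite_V _ form_sym])
    show "?N \<subseteq> V" using nonloops_subset by (auto simp: V_def)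
    show "\<forall>p\<in>?N. 0 < h p" using weight_pos nonloops_subset by (auto simp: h_def)
    show "\<forall>p\<in>?N. \<forall>q\<in>?N. 0 \<le> form (Suc j) A p q" by (simp add: form_nonneg)
    show "connected_on ?N (form (Suc j) A)" by (rule connected_form[OF Suc.prems(1) c])
    show "?N \<noteq> {}" using nonloops_nonempty[OF Suc.prems(1)] c by simp
    show "0 < (\<Sum>q\<in>V. form (Suc j) A p q * h q)" if "p \<in> ?N" for p
      using that row_form_pos[OF _ c] by blast
    \<comment> \<open>Outside \<open>?N\<close> lie the loops and the elements of \<open>A\<close>,
      whose rows vanish, and \<open>None\<close>, where \<open>h\<close> vanishes.\<close>
    show "h p * form (Suc j) A p q = 0" if "p \<in> V - ?N" "q \<in> V" for p q
    proof (cases p)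
      case (Some i)
      then have "form (Suc j) A p q = 0"
        using that form_eq_0[of i A "Suc j" q] by (auto simp: V_def nonloops_def)
      then show ?thesis by simp
    qed (simp add: h_def)
    fix v
    have "qform V (form (Suc j) A) v v = (\<Sum>i\<in>X - A. \<omega> i * qform V (form j (insert i A)) v v)"
      by (rule qform_form_Suc)
    also have "\<dots> = (\<Sum>i\<in>nonloops A. \<omega> i * qform V (form j (insert i A)) v v)"
    proof (rule sum.mono_neutral_right)
      show "\<forall>i\<in>X - A - nonloops A. \<omega> i * qform V (form j (insert i A)) v v = 0"
      proof
        fix i assume "i \<in> X - A - nonloops A"
        then have "insert i A \<notin> \<I>" by (auto simp: nonloops_def)
        then show "\<omega> i * qform V (form j (insert i A)) v v = 0" by (simp add: qform_dependent)
      qed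
    qed (use finite_ground in \<open>auto simp: nonloops_def\<close>)
    also have "\<dots> \<le> (\<Sum>i\<in>nonloops A. \<omega> i * (\<Sum>q\<in>V. form (Suc j) A (Some i) q * v q)\<^sup>2 /
        (\<Sum>q\<in>V. form (Suc j) A (Some i) q * h q))"
    proof (rule sum_mono)
      fix i assume i: "i \<in> nonloops A"
      then have iA: "i \<in> X - A" "insert i A \<in> \<I>" by (auto simp: nonloops_def)
      then have "Suc (card (insert i A) + j) = k"
        using Suc.prems finite_indep[OF Suc.prems(1)] by simp
      then have "hyperbolic V (form j (insert i A)) h" using Suc.IH iA by blast
      then have cs: "qform V (form j (insert i A)) h h * qform V (form j (insert i A)) v v
          \<le> (qform V (form j (insert i A)) h v)\<^sup>2"
        by (rule hyperbolic_reverse_cauchy_schwarz[OF form_sym])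
      have pos: "0 < qform V (form j (insert i A)) h h"
        using row_form_pos[OF i c] by (simp add: row_form_Suc[OF iA(1)])
      have "qform V (form j (insert i A)) v v \<le>
          (qform V (form j (insert i A)) h v)\<^sup>2 / qform V (form j (insert i A)) h h"
        using cs pos by (simp add: field_simps)
      then have "\<omega> i * qform V (form j (insert i A)) v v \<le>
          \<omega> i * ((qform V (form j (insert i A)) h v)\<^sup>2 / qform V (form j (insert i A)) h h)"
        using weight_pos iA by (intro mult_left_mono) (auto simp: less_imp_le)
      then show "\<omega> i * qform V (form j (insert i A)) v v \<le>
          \<omega> i * (\<Sum>q\<in>V. form (Suc j) A (Some i) q * v q)\<^sup>2 /
          (\<Sum>q\<in>V. form (Suc j) A (Some i) q * h q)"
        by (simp add: row_form_Suc[OF iA(1)])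
    qed
    finally show "qform V (form (Suc j) A) v v \<le>
        (\<Sum>p\<in>?N. h p * (\<Sum>q\<in>V. form (Suc j) A p q * v q)\<^sup>2 / (\<Sum>q\<in>V. form (Suc j) A p q * h q))"
      by (simp add: sum.reindex h_def)
  qed
qed

subsection \<open>The case of equality\<close>

text \<open>A null vector orthogonal to \<open>h\<close> lies in the kernel, and row
  \<open>i\<close> of this says that \<open>v\<close> is orthogonal to \<open>h\<close> for the form
  of A + i. Each of these forms is then nonpositive at \<open>v\<close>; since their weighted sum is
  zero, each is zero.\<close>

lemma kernel_propagates:
  assumes orth: "qform V (form (k - 1) {}) h v = 0" and null: "qform V (form (k - 1) {}) v v = 0"
    and "A \<in> \<I>" "Suc (card A + j) = k"
  shows "qform V (form j A) h v = 0 \<and> qform V (form j A) v v = 0"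
proof -
  have "finite A" using assms(3) by (rule finite_indep)
  then show ?thesis
    using assms(3,4)
  proof (induction A arbitrary: j rule: finite_induct)
    case empty
    then have "j = k - 1" by simp
    then show ?case using orth null by simp
  next
    case (insert i B)
    have B: "B \<in> \<I>" using indep_hereditary[OF insert.prems(1)] by blast
    have cB: "Suc (card B + Suc j) = k" using insert by simp
    have i: "i \<in> X - B" using insert indep_subset_ground by blast
    have IH: "qform V (form (Suc j) B) h v = 0" "qform V (form (Suc j) B) v v = 0"
      using insert.IH[OF B cB] by auto
    have row: "(\<Sum>q\<in>V. form (Suc j) B p q * v q) = 0" if "p \<in> V" for p
      using hyperbolic_null_vector[OF finite_V form_sym form_hyperbolic[OF B cB] IH that] .
    have h0: "qform V (form j (insert l B)) h v = 0" if "l \<in> X - B" for l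
      using row[of "Some l"] that row_form_Suc[OF that] by (simp add: V_def)
    have nonpos: "\<omega> l * qform V (form j (insert l B)) v v \<le> 0" if l: "l \<in> X - B" for l
    proof (cases "insert l B \<in> \<I>")
      case True
      then have "hyperbolic V (form j (insert l B)) h"
        using cB l insert.hyps by (intro form_hyperbolic) auto
      then have "qform V (form j (insert l B)) v v \<le> 0"
        using h0[OF l] by (simp add: hyperbolic_def)
      then show ?thesis using weight_pos l by (simp add: mult_nonneg_nonpos less_imp_le)
    qed (simp add: qform_dependent)
    have "(\<Sum>l\<in>X - B. - (\<omega> l * qform V (form j (insert l B)) v v)) = 0"
      using IH(2) by (simp add: qform_form_Suc sum_negf)
    then have "\<forall>l\<in>X - B. - (\<omega> l * qform V (form j (insert l B)) v v) = 0"
      using nonpos finite_ground by (subst (asm) sum_nonneg_eq_0_iff) auto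
    then have "qform V (form j (insert i B)) v v = 0" using i weight_pos by force
    then show ?case using h0[OF i] by simp
  qed
qed

text \<open>The \<open>None\<close> row says that the scaled weights of the non-loops sum to
  \<open>m\<close>, and row \<open>i\<close> that those in the class of \<open>i\<close> sum to 1.
  So there are m = |X - A| classes, which forces singletons and excludes loops.\<close>

lemma base_kernel:
  assumes A: "A \<in> \<I>" "Suc (card A) = k"
    and v: "v None = 1" "\<And>i. v (Some i) = - c * \<omega> i"
    and row: "\<And>p. p \<in> V \<Longrightarrow> (\<Sum>q\<in>V. base p q A * v q) = 0"
  shows "\<And>i. i \<in> X - A \<Longrightarrow> c * \<omega> i = 1"
    and "\<And>i l. i \<in> X - A \<Longrightarrow> l \<in> X - A \<Longrightarrow> i \<noteq> l \<Longrightarrow> insert i (insert l A) \<in> \<I>"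
proof -
  let ?cl = "parallel_class A"
  have total: "(\<Sum>i\<in>nonloops A. c * \<omega> i) = m"
  proof -
    have "None \<in> V" by (simp add: V_def)
    from row[OF this] show ?thesis
      using m_ge_2 by (simp add: row_base_None[OF A(1)] v sum_negf)
  qed
  have per_class: "(\<Sum>l\<in>{l\<in>nonloops A. ?cl l = ?cl i}. c * \<omega> l) = 1" if i: "i \<in> nonloops A" for i
  proof -
    have "Some i \<in> V" using i nonloops_subset by (auto simp: V_def)
    from row[OF this] show ?thesis
      using total by (simp add: row_base_Some[OF A(1) i] v sum_negf)
  qed
  have "m = (\<Sum>C\<in>?cl ` nonloops A. \<Sum>l\<in>{l\<in>nonloops A. ?cl l = C}. c * \<omega> l)"
    using sum.image_gen[OF finite_nonloops, of "\<lambda>i. c * \<omega> i" A ?cl] total by simp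
  also have "\<dots> = (\<Sum>C\<in>?cl ` nonloops A. 1)"
    by (intro sum.cong refl) (auto simp: per_class)
  finally have "real (card (?cl ` nonloops A)) = m" by simp
  then have card: "card (?cl ` nonloops A) = card (nonloops A)" "card (nonloops A) = card (X - A)"
    using card_parallel_classes[OF A] by linarith+
  have nonloops: "nonloops A = X - A"
    using card(2) finite_ground by (intro card_subset_eq) (auto simp: nonloops_def)
  have inj: "inj_on ?cl (nonloops A)" using card(1) finite_nonloops by (intro eq_card_imp_inj_on)
  show "c * \<omega> i = 1" if "i \<in> X - A" for i
  proof -
    have i: "i \<in> nonloops A" using that nonloops by simp
    then have "{l\<in>nonloops A. ?cl l = ?cl i} = {i}" using inj by (auto dest: inj_onD)
    then show ?thesis using per_class[OF i] by simp
  qed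
  show "insert i (insert l A) \<in> \<I>" if "i \<in> X - A" "l \<in> X - A" "i \<noteq> l" for i l
    using that nonloops inj parallel_class_eq_iff[OF A(1), of i l] by (auto dest: inj_onD)
qed

text \<open>Starting from some independent set of size k + 1, elements outside \<open>U\<close> are
  exchanged one by one for elements of \<open>U\<close>; induction on the number of missing
  elements.\<close>

lemma all_indep_by_exchange:
  assumes ext2: "\<And>A i l. A \<in> \<I> \<Longrightarrow> Suc (card A) = k \<Longrightarrow> i \<in> X - A \<Longrightarrow> l \<in> X - A \<Longrightarrow> i \<noteq> l \<Longrightarrow>
      insert i (insert l A) \<in> \<I>"
    and U: "U \<subseteq> X" "card U = Suc k"
  shows "U \<in> \<I>"
proof -
  have finU: "finite U" using U finite_ground finite_subset by blast
  have step: "U \<in> \<I>" if "S \<in> \<I>" "card S = Suc k" "card (U - S) = d" for S d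
    using that
  proof (induction d arbitrary: S)
    case 0
    then have "U \<subseteq> S" using finU by simp
    then show ?case using indep_hereditary 0 by blast
  next
    case (Suc d)
    have finS: "finite S" using Suc.prems(1) by (rule finite_indep)
    obtain y where y: "y \<in> U - S" using Suc.prems(3) by (metis card.empty ex_in_conv nat.distinct(1))
    have "\<not> S \<subseteq> U"
    proof
      assume "S \<subseteq> U"
      then have "S = U" using finU U(2) Suc.prems(2) by (intro card_subset_eq) auto
      then show False using y by blast
    qed
    then obtain x where x: "x \<in> S - U" by blast
    have "card (S - {x}) = k" using x finS Suc.prems(2) by simp
    \<comment> \<open>A spare element \<open>x'\<close> is also removed, leaving the
      \<open>k - 1\<close> elements that \<open>ext2\<close> needs; it is put back together with
      \<open>y\<close>.\<close>
    then obtain x' where x': "x' \<in> S - {x}" using k_pos by (metis card.empty ex_in_conv not_one_le_zero)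
    define A where "A = S - {x} - {x'}"
    have cA: "Suc (card A) = k"
      using x' finS \<open>card (S - {x}) = k\<close> k_pos by (simp add: A_def)
    have "A \<in> \<I>" using indep_hereditary[OF Suc.prems(1), of A] by (auto simp: A_def)
    then have *: "insert y (insert x' A) \<in> \<I>"
      using ext2[OF _ cA, of y x'] y x' U indep_subset_ground[OF Suc.prems(1)] by (auto simp: A_def)
    have eq: "insert y (insert x' A) = insert y (S - {x})" using x' by (auto simp: A_def)
    have "U - insert y (S - {x}) = (U - S) - {y}" using x by auto
    then have "card (U - insert y (S - {x})) = d" using Suc.prems(3) y finU by simp
    moreover have "card (insert y (S - {x})) = Suc k"
      using y finS \<open>card (S - {x}) = k\<close> by simp
    ultimately show ?case using Suc.IH * eq by simp
  qed
  obtain S0 where "S0 \<in> \<I>" "Suc k \<le> card S0" by (rule large_indep)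
  then obtain S where "S \<subseteq> S0" "card S = Suc k" by (meson obtain_subset_with_card_n)
  then show ?thesis using step[of S] \<open>S0 \<in> \<I>\<close> indep_hereditary by blast
qed

lemma indep_of_all_large:
  assumes "\<And>U. U \<subseteq> X \<Longrightarrow> card U = Suc k \<Longrightarrow> U \<in> \<I>" "S \<subseteq> X" "card S \<le> Suc k"
  shows "S \<in> \<I>"
proof -
  obtain U where "S \<subseteq> U" "U \<subseteq> X" "card U = Suc k"
    using exists_subset_between[of S "Suc k" X] assms(2,3) k_less_card finite_ground by auto
  then show ?thesis using assms(1) indep_hereditary by blast
qed

section \<open>The form of the empty set in terms of weighted counts\<close>

lemma chain_sum_indep:
  "chain_sum X \<omega> j (\<lambda>S. of_bool (S \<in> \<I>)) {} = fact j * weighted_indep_count \<I> \<omega> j"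
proof -
  have "weighted_indep_count \<I> \<omega> j = (\<Sum>S | S \<subseteq> X \<and> card S = j. (\<Prod>x\<in>S. \<omega> x) * of_bool (S \<in> \<I>))"
    unfolding weighted_indep_count_def indep_of_size_def set_weight_def
    using finite_ground indep_subset_ground by (intro sum.mono_neutral_cong_left) auto
  then show ?thesis by (simp add: chain_sum_empty[OF finite_ground])
qed

text \<open>The direction \<open>(1, 0)\<close> of the homogenizing variable.\<close>

definition e :: "'a option \<Rightarrow> real" where "e p = of_bool (p = None)"

lemma qform_e_e:
  "qform V (form (k - 1) {}) e e = m * (m - 1) * (fact (k - 1) * weighted_indep_count \<I> \<omega> (k - 1))"
proof -
  have "qform V (\<lambda>p q. base p q S) e e = m * (m - 1) * of_bool (S \<in> \<I>)" for S
    by (simp add: qform_rows sum_V e_def base_def)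
  then show ?thesis by (simp add: qform_form chain_sum_scale chain_sum_indep)
qed

text \<open>Pairing with \<open>h\<close> appends one weighted element to each chain, turning
  \<open>k - 1\<close> steps into \<open>k\<close>; pairing with \<open>h\<close> twice gives
  \<open>k + 1\<close>.\<close>

lemma qform_h_e:
  "qform V (form (k - 1) {}) h e = (m - 1) * (fact k * weighted_indep_count \<I> \<omega> k)"
proof -
  have "qform V (\<lambda>p q. base p q S) h e =
      (m - 1) * (\<Sum>i\<in>X - S. \<omega> i * of_bool (insert i S \<in> \<I>))" for S
  proof -
    have "qform V (\<lambda>p q. base p q S) h e = (\<Sum>i\<in>X. \<omega> i * base (Some i) None S)"
      by (simp add: qform_h sum_V e_def)
    also have "\<dots> = (\<Sum>i\<in>X - S. \<omega> i * base (Some i) None S)"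
      using finite_ground by (intro sum.mono_neutral_right) (auto simp: base_def)
    finally show ?thesis
      by (simp add: base_def sum_distrib_left mult.left_commute cong: sum.cong_simp)
  qed
  then have "qform V (form (k - 1) {}) h e =
      (m - 1) * chain_sum X \<omega> (Suc (k - 1)) (\<lambda>S. of_bool (S \<in> \<I>)) {}"
    unfolding chain_sum_Suc_right by (simp add: qform_form chain_sum_scale)
  then show ?thesis using k_pos unfolding chain_sum_indep by simp
qed

lemma qform_h_h:
  "qform V (form (k - 1) {}) h h = fact (k + 1) * weighted_indep_count \<I> \<omega> (k + 1)"
proof -
  let ?I = "\<lambda>S. of_bool (S \<in> \<I>) :: real"
  have "qform V (\<lambda>p q. base p q S) h h =
      (\<Sum>i\<in>X - S. \<omega> i * (\<Sum>l\<in>X - insert i S. \<omega> l * ?I (insert l (insert i S))))" for S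
  proof -
    have "qform V (\<lambda>p q. base p q S) h h = (\<Sum>i\<in>X. \<omega> i * (\<Sum>l\<in>X. base (Some i) (Some l) S * \<omega> l))"
      by (simp add: qform_h sum_V h_def)
    also have "\<dots> = (\<Sum>i\<in>X - S. \<omega> i * (\<Sum>l\<in>X. base (Some i) (Some l) S * \<omega> l))"
      using finite_ground by (intro sum.mono_neutral_right) (auto simp: base_def)
    also have "\<dots> = (\<Sum>i\<in>X - S. \<omega> i * (\<Sum>l\<in>X - insert i S. \<omega> l * ?I (insert l (insert i S))))"
    proof (intro sum.cong refl)
      fix i assume "i \<in> X - S"
      then have "(\<Sum>l\<in>X. base (Some i) (Some l) S * \<omega> l) =
          (\<Sum>l\<in>X - insert i S. \<omega> l * ?I (insert l (insert i S)))"
        using finite_ground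
        by (intro sum.mono_neutral_cong_right) (auto simp: base_def insert_commute)
      then show "\<omega> i * (\<Sum>l\<in>X. base (Some i) (Some l) S * \<omega> l) =
          \<omega> i * (\<Sum>l\<in>X - insert i S. \<omega> l * ?I (insert l (insert i S)))"
        by (rule arg_cong)
    qed
    finally show ?thesis .
  qed
  then have "qform V (form (k - 1) {}) h h = chain_sum X \<omega> (Suc (Suc (k - 1))) ?I {}"
    unfolding chain_sum_Suc_right by (simp add: qform_form)
  then show ?thesis using k_pos unfolding chain_sum_indep by simp
qed

lemma mason_equality_imp:
  assumes eq: "(weighted_indep_count \<I> \<omega> k)\<^sup>2 =
      (1 + 1 / real k) * (1 + 1 / (real (card X) - real k))
        * weighted_indep_count \<I> \<omega> (k - 1) * weighted_indep_count \<I> \<omega> (k + 1)"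
  shows "\<And>S. S \<subseteq> X \<Longrightarrow> card S \<le> k + 1 \<Longrightarrow> S \<in> \<I>"
    and "\<And>x y. x \<in> X \<Longrightarrow> y \<in> X \<Longrightarrow> \<omega> x = \<omega> y"
proof -
  let ?G = "form (k - 1) {}"
  \<comment> \<open>This \<open>c\<close> makes \<open>v\<close> orthogonal to \<open>h\<close>;
    equality in reverse Cauchy-Schwarz for \<open>h\<close> and \<open>e\<close> then says that
    \<open>v\<close> is null.\<close>
  define c where "c = qform V ?G h e / qform V ?G h h"
  define v where "v p = e p + (- c) * h p" for p
  have pos: "0 < qform V ?G h h" using qform_form_pos[OF empty_indep] k_pos by simp
  have "(qform V ?G h e)\<^sup>2 = qform V ?G h h * qform V ?G e e"
  proof -
    have f: "fact k = real k * fact (k - 1)" "fact (k + 1) = (real k + 1) * (real k * fact (k - 1))"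
      using k_pos by (cases k; simp)+
    \<comment> \<open>Hence 1 + 1/(n - k) is m / (m - 1), and the remaining factors are ratios of
      the factorials in \<open>f\<close>.\<close>
    have n: "real (card X) - real k = m - 1" by (simp add: m_def)
    have "real k * (m - 1) * (weighted_indep_count \<I> \<omega> k)\<^sup>2 = (real k + 1) * m
        * weighted_indep_count \<I> \<omega> (k - 1) * weighted_indep_count \<I> \<omega> (k + 1)"
      unfolding eq n using k_pos m_ge_2 by (simp add: field_simps)
    then show ?thesis
      unfolding qform_h_e qform_h_h qform_e_e f by algebra
  qed
  then have null: "qform V ?G v v = 0"
    unfolding v_def qform_add_scaled[OF form_sym] qform_commute[OF form_sym, where v = e and w = h]
    unfolding c_def using pos by (simp add: field_simps) (simp add: power2_eq_square)
  have orth: "qform V ?G h v = 0"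
    unfolding v_def qform_add_scaled_right using pos by (simp add: c_def)
  have row: "(\<Sum>q\<in>V. base p q A * v q) = 0" if A: "A \<in> \<I>" "Suc (card A) = k" and p: "p \<in> V" for A p
  proof -
    have c0: "Suc (card A + 0) = k" using A by simp
    have "qform V (form 0 A) h v = 0" "qform V (form 0 A) v v = 0"
      using kernel_propagates[OF orth null A(1) c0] by auto
    from hyperbolic_null_vector[OF finite_V form_sym form_hyperbolic[OF A(1) c0] this p]
    show ?thesis by (simp add: form_0)
  qed
  have v: "v None = 1" "v (Some i) = - c * \<omega> i" for i
    by (simp_all add: v_def e_def h_def)
  have large: "U \<in> \<I>" if "U \<subseteq> X" "card U = Suc k" for U
    using base_kernel(2)[OF _ _ v row] by (rule all_indep_by_exchange[OF _ that])
  show indep: "S \<in> \<I>" if "S \<subseteq> X" "card S \<le> k + 1" for S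
    using large by (rule indep_of_all_large) (use that in auto)
  have "c * \<omega> x = 1" if x: "x \<in> X" for x
  proof -
    \<comment> \<open>To read off the weight of \<open>x\<close>, choose a (k-1)-set
      \<open>A\<close> avoiding \<open>x\<close>; it is independent by \<open>indep\<close>.\<close>
    have "k - 1 \<le> card (X - {x})" using x k_less_card finite_ground by simp
    then obtain A where A: "A \<subseteq> X - {x}" "card A = k - 1" by (meson obtain_subset_with_card_n)
    then have "A \<in> \<I>" "Suc (card A) = k" using k_pos by (auto intro!: indep)
    then show ?thesis using base_kernel(1)[OF _ _ v row] A x by blast
  qed
  then show "\<omega> x = \<omega> y" if "x \<in> X" "y \<in> X" for x y
  proof -
    have "c * \<omega> x = c * \<omega> y" "c \<noteq> 0" using that \<open>\<And>x. x \<in> X \<Longrightarrow> c * \<omega> x = 1\<close> by force+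
    then show ?thesis by simp
  qed
qed

end

section \<open>Girth, uniform weights and the converse direction\<close>

lemma (in matroid) girth_gt_iff:
  "enat j < girth X \<I> \<longleftrightarrow> (\<forall>S. S \<subseteq> X \<longrightarrow> card S \<le> j \<longrightarrow> S \<in> \<I>)"
proof
  assume less: "enat j < girth X \<I>"
  show "\<forall>S. S \<subseteq> X \<longrightarrow> card S \<le> j \<longrightarrow> S \<in> \<I>"
  proof (intro allI impI)
    fix S assume S: "S \<subseteq> X" "card S \<le> j"
    have "\<not> indep_count \<I> (card S) < card X choose card S"
    proof
      assume "indep_count \<I> (card S) < card X choose card S"
      then have "girth X \<I> \<le> enat (card S)" unfolding girth_def by (intro INF_lower) simp
      then show False using less S(2) by (meson enat_ord_simps(1) leD le_less_trans order_trans)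
    qed
    \<comment> \<open>The independent sets of this size form a subfamily of all such subsets with
      full cardinality, hence the whole family.\<close>
    then have "card {T. T \<subseteq> X \<and> card T = card S} \<le> card (indep_of_size \<I> (card S))"
      by (simp add: indep_count_def n_subsets[OF finite_ground])
    then have "indep_of_size \<I> (card S) = {T. T \<subseteq> X \<and> card T = card S}"
      using finite_ground indep_subset_ground
      by (intro card_seteq) (auto simp: indep_of_size_def)
    then show "S \<in> \<I>" using S by (auto simp: indep_of_size_def)
  qed
next
  assume all: "\<forall>S. S \<subseteq> X \<longrightarrow> card S \<le> j \<longrightarrow> S \<in> \<I>"
  have "enat (Suc j) \<le> girth X \<I>"
    unfolding girth_def
  proof (rule INF_greatest)
    fix i assume "i \<in> {i. indep_count \<I> i < card X choose i}"
    then have i: "indep_count \<I> i < card X choose i" by simp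
    have "\<not> i \<le> j"
    proof
      assume "i \<le> j"
      then have "indep_of_size \<I> i = {T. T \<subseteq> X \<and> card T = i}"
        using all indep_subset_ground by (auto simp: indep_of_size_def)
      then show False using i by (simp add: indep_count_def n_subsets[OF finite_ground])
    qed
    then show "enat (Suc j) \<le> enat i" by simp
  qed
  then show "enat j < girth X \<I>" by (meson enat_ord_simps(2) lessI less_le_trans)
qed

lemma (in matroid) weighted_indep_count_uniform:
  assumes "\<forall>S. S \<subseteq> X \<longrightarrow> card S = j \<longrightarrow> S \<in> \<I>" and "\<And>x. x \<in> X \<Longrightarrow> \<omega> x = a"
  shows "weighted_indep_count \<I> \<omega> j = real (card X choose j) * a ^ j"
proof -
  have "weighted_indep_count \<I> \<omega> j = (\<Sum>S | S \<subseteq> X \<and> card S = j. a ^ j)"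
    unfolding weighted_indep_count_def set_weight_def
  proof (rule sum.cong)
    show "indep_of_size \<I> j = {S. S \<subseteq> X \<and> card S = j}"
      using assms(1) indep_subset_ground by (auto simp: indep_of_size_def)
    fix S assume S: "S \<in> {S. S \<subseteq> X \<and> card S = j}"
    then have "(\<Prod>x\<in>S. \<omega> x) = (\<Prod>x\<in>S. a)" using assms(2) by (intro prod.cong) auto
    then show "(\<Prod>x\<in>S. \<omega> x) = a ^ j" using S by simp
  qed
  then show ?thesis by (simp add: n_subsets[OF finite_ground])
qed

text \<open>Two instances of (i + 1) C(n, i + 1) = (n - i) C(n, i), at i = k - 1 and i = k, express
  both neighbours through C(n, k).\<close>

lemma binomial_log_concavity_ratio:
  assumes "1 \<le> k" "k < n"
  shows "(real (n choose k))\<^sup>2 = (1 + 1 / real k) * (1 + 1 / (real n - real k))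
    * real (n choose (k - 1)) * real (n choose (k + 1))"
proof -
  have step: "real (Suc i) * real (n choose Suc i) = (real n - real i) * real (n choose i)"
    if "i < n" for i
  proof -
    have "Suc i * (n choose Suc i) = (n - i) * (n choose i)"
      using that by (metis binomial_absorb_comp binomial_absorption)
    then show ?thesis using that by (metis of_nat_diff of_nat_mult less_imp_le)
  qed
  define d where "d = real n - real k"
  have d: "0 < d" "0 < real k" using assms by (simp_all add: d_def)
  have 1: "real k * real (n choose k) = (d + 1) * real (n choose (k - 1))"
    using step[of "k - 1"] assms by (simp add: d_def)
  have 2: "(real k + 1) * real (n choose (k + 1)) = d * real (n choose k)"
    using step[of k] assms by (simp add: d_def add.commute)
  have "(1 + 1 / real k) * (1 + 1 / d) * real (n choose (k - 1)) * real (n choose (k + 1)) =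
      ((d + 1) * real (n choose (k - 1))) * ((real k + 1) * real (n choose (k + 1))) / (real k * d)"
    using d by (simp add: field_simps)
  also have "\<dots> = (real (n choose k))\<^sup>2"
    unfolding 1[symmetric] 2 using d by (simp add: power2_eq_square)
  finally show ?thesis by (simp add: d_def)
qed

theorem theorem1p9:
  fixes X :: "'a set" and \<I> :: "'a set set" and \<omega> :: "'a \<Rightarrow> real" and n k :: nat
  assumes "matroid X \<I>"
    and "card X = n"
    and "1 \<le> k" and "k < matroid_rank \<I>"
    and "\<forall>x\<in>X. 0 < \<omega> x"
  shows "(weighted_indep_count \<I> \<omega> k)\<^sup>2 =
           (1 + 1 / real k) * (1 + 1 / (real n - real k))
             * weighted_indep_count \<I> \<omega> (k - 1) * weighted_indep_count \<I> \<omega> (k + 1)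
         \<longleftrightarrow> enat (k + 1) < girth X \<I> \<and> (\<forall>x\<in>X. \<forall>y\<in>X. \<omega> x = \<omega> y)"
proof -
  interpret truncated_weighted_matroid X \<I> \<omega> k
    using assms unfolding truncated_weighted_matroid_def truncated_weighted_matroid_axioms_def
    by blast
  show ?thesis
  proof
    assume "(weighted_indep_count \<I> \<omega> k)\<^sup>2 =
           (1 + 1 / real k) * (1 + 1 / (real n - real k))
             * weighted_indep_count \<I> \<omega> (k - 1) * weighted_indep_count \<I> \<omega> (k + 1)"
    then have eq: "(weighted_indep_count \<I> \<omega> k)\<^sup>2 =
           (1 + 1 / real k) * (1 + 1 / (real (card X) - real k))
             * weighted_indep_count \<I> \<omega> (k - 1) * weighted_indep_count \<I> \<omega> (k + 1)"
      using assms(2) by simp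
    then show "enat (k + 1) < girth X \<I> \<and> (\<forall>x\<in>X. \<forall>y\<in>X. \<omega> x = \<omega> y)"
      unfolding girth_gt_iff using mason_equality_imp by blast
  next
    assume R: "enat (k + 1) < girth X \<I> \<and> (\<forall>x\<in>X. \<forall>y\<in>X. \<omega> x = \<omega> y)"
    then have indep: "\<forall>S. S \<subseteq> X \<longrightarrow> card S \<le> k + 1 \<longrightarrow> S \<in> \<I>" by (simp add: girth_gt_iff)
    \<comment> \<open>The ground set has more than \<open>k\<close> elements, so a reference element
      for the common weight exists.\<close>
    obtain x0 where "x0 \<in> X" using k_less_card by fastforce
    then have a: "\<omega> x = \<omega> x0" if "x \<in> X" for x using R that by blast
    have W: "weighted_indep_count \<I> \<omega> j = real (n choose j) * \<omega> x0 ^ j" if "j \<le> k + 1" for j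
      using weighted_indep_count_uniform[OF _ a, of j] indep that assms(2) by auto
    \<comment> \<open>The exponents add up to \<open>2 * k\<close> since \<open>1 \<le> k\<close>
      keeps \<open>k - 1\<close> from being truncated.\<close>
    have pw: "(\<omega> x0 ^ k)\<^sup>2 = \<omega> x0 ^ (k - 1) * \<omega> x0 ^ (k + 1)"
      using assms(3) by (cases k) (simp_all add: power2_eq_square)
    have "(weighted_indep_count \<I> \<omega> k)\<^sup>2 = (real (n choose k))\<^sup>2 * (\<omega> x0 ^ k)\<^sup>2"
      by (simp add: W power_mult_distrib)
    also have "\<dots> = (1 + 1 / real k) * (1 + 1 / (real n - real k))
        * (real (n choose (k - 1)) * \<omega> x0 ^ (k - 1)) * (real (n choose (k + 1)) * \<omega> x0 ^ (k + 1))"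
      using assms(3) k_less_card assms(2)
      unfolding pw by (subst binomial_log_concavity_ratio) (simp_all only: mult_ac)
    finally show "(weighted_indep_count \<I> \<omega> k)\<^sup>2 =
           (1 + 1 / real k) * (1 + 1 / (real n - real k))
             * weighted_indep_count \<I> \<omega> (k - 1) * weighted_indep_count \<I> \<omega> (k + 1)"
      by (simp add: W)
  qed
qed

end
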